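(* Let $w$ be a weight on $\mathbb{R}^n$ and $M$ the Hardy–Littlewood maximal operator. (1) Let $1\le p<\infty$. If $M$ is bounded from $\mathcal M^{p}(\varphi,w)$ to $W\mathcal M^{p}(\varphi,w)$, then $w\in A(\mathcal M^{p}(\varphi))$. (2) Let $1<p<\infty$. If $w\in A(\mathcal M^{p}(\varphi))$ and $w(\cdot+a)\in A_{p,\mathrm{loc}}$ for some $a\in\mathbb{R}^n$, then $M$ is bounded on $\mathcal M^{p}(\varphi,w)$. (3) If $w\in A(\mathcal M^{1}(\varphi))$ and $w(\cdot+a)\in A_{1,\mathrm{loc}}$ for some $a\in\mathbb{R}^n$, then $M$ is bounded from $\mathcal M^{1}(\varphi,w)$ to $W\mathcal M^{1}(\varphi,w)$.
   Context: A weight is a nonnegative locally integrable function on $\mathbb{R}^n$. Let $\varphi$ be a function from the set of Euclidean balls of $\mathbb{R}^n$ to $(0,\infty)$; standing assumptions: $\varphi$ is doubling ($\varphi(2B)\le C\varphi(B)$) and reverse doubling (there are $\delta>0$, $C$ with $\varphi(B_1)/\varphi(B_2)\le C(|B_1|/|B_2|)^\delta$ for balls $B_1\subset B_2$), and characteristic functions of balls belong to $\mathcal M^{p}(\varphi,w)$. $\mathcal M^{p}(\varphi,w)$: measurable $f$ with $\|f\|_{\mathcal M^{p}(\varphi,w)}:=\sup_B\big(\varphi(B)^{-1}\int_B|f|^pw\big)^{1/p}<\infty$ (supremum over all balls); $W\mathcal M^{p}(\varphi,w)$: $\|f\|_{W\mathcal M^{p}(\varphi,w)}:=\sup_B\sup_{t>0}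 t\, w(\{x\in B:|f(x)|>t\})^{1/p}\varphi(B)^{-1/p}<\infty$. Köthe dual: $\|g\|_{X'}:=\sup\{\int|fg|:\|f\|_X\le1\}$. $A(\mathcal M^{p}(\varphi))$: weights with $\sup_B\|\chi_B\|_{\mathcal M^{p}(\varphi,w)}\|\chi_B\|_{\mathcal M^{p}(\varphi,w)'}/|B|<\infty$, over all balls. Fix $\kappa\in(0,1)$ and let $\mathcal B_{\kappa,\mathrm{loc}}$ be the balls $B$ with radius $r_B<\kappa|c_B|$ ($c_B$ the center). For $1<p<\infty$, $w\in A_{p,\mathrm{loc}}$ means $\sup_{B\in\mathcal B_{\kappa,\mathrm{loc}}} w(B)^{1/p}\big(\int_B w^{1-p'}\big)^{1/p'}/|B|<\infty$; $w\in A_{1,\mathrm{loc}}$ means $w(B)/|B|\le C\operatorname{ess\,inf}_B w$ for all $B\in\mathcal B_{\kappa,\mathrm{loc}}$. These classes do not depend on $\kappa$. *)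

theory Defs
  imports "HOL-Analysis.Analysis"
begin

definition enn_pow :: "real \<Rightarrow> ennreal \<Rightarrow> ennreal" where
  "enn_pow p x = (if x = \<infinity> then \<infinity> else ennreal (enn2real x powr p))"

definition weight :: "('a::euclidean_space \<Rightarrow> real) \<Rightarrow> bool" where
  "weight w \<longleftrightarrow> (\<forall>x. 0 \<le> w x) \<and> w \<in> borel_measurable lebesgue
     \<and> (\<forall>c r. set_integrable lebesgue (cball c r) w)"

definition wmeas :: "('a::euclidean_space \<Rightarrow> real) \<Rightarrow> 'a set \<Rightarrow> ennreal" where
  "wmeas w E = (\<integral>\<^sup>+ x\<in>E. ennreal (w x) \<partial>lebesgue)"

text \<open>Weighted Morrey norm of |f| (given as an ennreal-valued function);
  supremum over all open balls B = ball c r, r > 0.\<close>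
definition morrey_norm ::
  "real \<Rightarrow> ('a::euclidean_space set \<Rightarrow> real) \<Rightarrow> ('a \<Rightarrow> real) \<Rightarrow> ('a \<Rightarrow> ennreal) \<Rightarrow> ennreal" where
  "morrey_norm p \<phi> w g =
     (SUP (c, r) \<in> {(c, r). 0 < r}.
        enn_pow (1 / p) (ennreal (1 / \<phi> (ball c r)) *
          (\<integral>\<^sup>+ x\<in>ball c r. enn_pow p (g x) * ennreal (w x) \<partial>lebesgue)))"

definition weak_morrey_norm ::
  "real \<Rightarrow> ('a::euclidean_space set \<Rightarrow> real) \<Rightarrow> ('a \<Rightarrow> real) \<Rightarrow> ('a \<Rightarrow> ennreal) \<Rightarrow> ennreal" where
  "weak_morrey_norm p \<phi> w g =
     (SUP (c, r, t) \<in> {(c, r, t). 0 < r \<and> 0 < t}.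
        ennreal t * enn_pow (1 / p)
          (wmeas w {x \<in> ball c r. g x > ennreal t} * ennreal (1 / \<phi> (ball c r))))"

definition kothe_norm ::
  "(('a::euclidean_space \<Rightarrow> ennreal) \<Rightarrow> ennreal) \<Rightarrow> ('a \<Rightarrow> real) \<Rightarrow> ennreal" where
  "kothe_norm X g =
     (SUP f \<in> {f :: 'a \<Rightarrow> real. f \<in> borel_measurable lebesgue \<and> X (\<lambda>x. ennreal \<bar>f x\<bar>) \<le> 1}.
        \<integral>\<^sup>+ x. ennreal \<bar>f x * g x\<bar> \<partial>lebesgue)"

definition A_morrey ::
  "real \<Rightarrow> ('a::euclidean_space set \<Rightarrow> real) \<Rightarrow> ('a \<Rightarrow> real) \<Rightarrow> bool" where
  "A_morrey p \<phi> w \<longleftrightarrow> (\<exists>C::real. \<forall>c r. 0 < r \<longrightarrow>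
      morrey_norm p \<phi> w (\<lambda>x. ennreal (indicator (ball c r) x))
      * kothe_norm (morrey_norm p \<phi> w) (indicator (ball c r))
      \<le> ennreal C * emeasure lebesgue (ball c r))"

definition A_p_loc :: "real \<Rightarrow> real \<Rightarrow> ('a::euclidean_space \<Rightarrow> real) \<Rightarrow> bool" where
  "A_p_loc \<kappa> p w \<longleftrightarrow> (\<exists>C::real. \<forall>c r. 0 < r \<and> r < \<kappa> * norm c \<longrightarrow>
      enn_pow (1 / p) (wmeas w (ball c r)) *
      enn_pow (1 - 1 / p)
        (\<integral>\<^sup>+ x\<in>ball c r. (if w x = 0 then \<infinity> else ennreal (w x powr (1 - p / (p - 1)))) \<partial>lebesgue)
      \<le> ennreal C * emeasure lebesgue (ball c r))"

definition A_1_loc :: "real \<Rightarrow> ('a::euclidean_space \<Rightarrow> real) \<Rightarrow> bool" where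
  "A_1_loc \<kappa> w \<longleftrightarrow> (\<exists>C::real. \<forall>c r. 0 < r \<and> r < \<kappa> * norm c \<longrightarrow>
      (AE x in lebesgue. x \<in> ball c r \<longrightarrow>
         wmeas w (ball c r) \<le> ennreal C * emeasure lebesgue (ball c r) * ennreal (w x)))"

definition hl_max :: "('a::euclidean_space \<Rightarrow> real) \<Rightarrow> 'a \<Rightarrow> ennreal" where
  "hl_max f x = (SUP (c, r) \<in> {(c, r). 0 < r \<and> x \<in> ball c r}.
      (\<integral>\<^sup>+ y\<in>ball c r. ennreal \<bar>f y\<bar> \<partial>lebesgue) / emeasure lebesgue (ball c r))"

definition phi_admissible ::
  "real \<Rightarrow> ('a::euclidean_space set \<Rightarrow> real) \<Rightarrow> ('a \<Rightarrow> real) \<Rightarrow> bool" where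
  "phi_admissible p \<phi> w \<longleftrightarrow>
     (\<forall>c r. 0 < r \<longrightarrow> 0 < \<phi> (ball c r))
   \<and> (\<exists>C. \<forall>c r. 0 < r \<longrightarrow> \<phi> (ball c (2 * r)) \<le> C * \<phi> (ball c r))
   \<and> (\<exists>\<delta> C. 0 < \<delta> \<and> (\<forall>c1 r1 c2 r2. 0 < r1 \<longrightarrow> 0 < r2 \<longrightarrow> ball c1 r1 \<subseteq> ball c2 r2 \<longrightarrow>
        \<phi> (ball c1 r1) / \<phi> (ball c2 r2)
          \<le> C * (measure lebesgue (ball c1 r1) / measure lebesgue (ball c2 r2)) powr \<delta>))
   \<and> (\<forall>c r. 0 < r \<longrightarrow> morrey_norm p \<phi> w (\<lambda>x. ennreal (indicator (ball c r) x)) < \<infinity>)"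

definition M_bdd_weak :: "real \<Rightarrow> ('a::euclidean_space set \<Rightarrow> real) \<Rightarrow> ('a \<Rightarrow> real) \<Rightarrow> bool" where
  "M_bdd_weak p \<phi> w \<longleftrightarrow> (\<exists>C::real. \<forall>f. f \<in> borel_measurable lebesgue \<longrightarrow>
      morrey_norm p \<phi> w (\<lambda>x. ennreal \<bar>f x\<bar>) < \<infinity> \<longrightarrow>
      weak_morrey_norm p \<phi> w (hl_max f) \<le> ennreal C * morrey_norm p \<phi> w (\<lambda>x. ennreal \<bar>f x\<bar>))"

definition M_bdd :: "real \<Rightarrow> ('a::euclidean_space set \<Rightarrow> real) \<Rightarrow> ('a \<Rightarrow> real) \<Rightarrow> bool" where
  "M_bdd p \<phi> w \<longleftrightarrow> (\<exists>C::real. \<forall>f. f \<in> borel_measurable lebesgue \<longrightarrow>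
      morrey_norm p \<phi> w (\<lambda>x. ennreal \<bar>f x\<bar>) < \<infinity> \<longrightarrow>
      morrey_norm p \<phi> w (hl_max f) \<le> ennreal C * morrey_norm p \<phi> w (\<lambda>x. ennreal \<bar>f x\<bar>))"

end

theory Submission
  imports Defs
begin

text \<open>
  Necessity: \<open>hl_max f\<close> exceeds the average of \<open>f\<close> over \<open>B\<close> on all of \<open>B\<close>, so the weak bound tested on
  \<open>f\<close> controls the norm of the indicator of \<open>B\<close> times that average.

  Sufficiency: let \<open>B\<close> be a ball that is small relative to its distance from \<open>a\<close>. The averages over
  larger balls are controlled by \<open>A_morrey\<close>. The smaller balls lie in the range of the local
  Muckenhoupt condition, where \<open>w\<close> and its dual weight are doubling, so Vitali's covering lemma bounds
  the associated weighted maximal operators and Lerner's argument (or, for \<open>p = 1\<close>, a direct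
  comparison) passes to the unweighted one. A general ball is covered, up to \<open>a\<close>, by small balls
  arranged in dyadic annuli around \<open>a\<close>, and reverse doubling of \<open>\<phi>\<close> makes the resulting sum geometric.
\<close>

section \<open>Powers and Morrey norms\<close>

text \<open>The weight may vanish on sets of positive measure. As \<open>0 * top = 0\<close>,
  \<open>A_p_loc\<close> is silent on balls of zero \<open>w\<close>-mass, and neither doubling nor
  a comparison with the dual weight is available there. The local families therefore contain only
  balls of positive mass. Nothing is lost: by Lindelof, \<open>w\<close>-almost every point lies
  only in balls of positive mass. Lerner's argument asks only for doubling of \<open>w\<close> and
  of the dual weight, so no self-improvement of the exponent \<open>p\<close> enters. Vitali's lemma
  dilates by 5, so the local condition must hold on a ball and on its fivefold dilate. Starting from
  balls of radius below \<open>\<kappa> / 10\<close> times the distance to \<open>a\<close> leaves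
  room for this for all smaller balls meeting them. Both conclusions are bounds of a measure on
  balls by a multiple of \<open>\<phi>\<close>: the measure with density
  \<open>(hl_max f)^p * w\<close> in the strong case, \<open>w\<close> restricted to one superlevel
  set of \<open>hl_max f\<close> in the weak case. Hence one covering lemma about arbitrary measures
  that do not charge \<open>a\<close> serves both.\<close>

lemma enn_pow_ennreal: "0 \<le> x \<Longrightarrow> enn_pow p (ennreal x) = ennreal (x powr p)"
  by (simp add: enn_pow_def)

lemma enn_pow_top [simp]: "enn_pow p top = top"
  by (simp add: enn_pow_def)

lemma enn_pow_0 [simp]: "enn_pow p 0 = 0"
  by (simp add: enn_pow_def)

lemma enn_pow_one_right [simp]: "enn_pow p 1 = 1"
  by (simp add: enn_pow_def)

lemma enn_pow_one_left [simp]: "enn_pow 1 x = x"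
  by (cases x) (simp_all add: enn_pow_ennreal)

lemma enn_pow_eq_0_iff [simp]: "enn_pow p x = 0 \<longleftrightarrow> x = 0"
  by (cases x) (auto simp: enn_pow_ennreal powr_gt_zero)

lemma enn_pow_eq_top_iff [simp]: "enn_pow p x = top \<longleftrightarrow> x = top"
  by (simp add: enn_pow_def)

lemma enn_pow_mono: "0 \<le> p \<Longrightarrow> x \<le> y \<Longrightarrow> enn_pow p x \<le> enn_pow p y"
  by (cases x; cases y) (auto simp: enn_pow_ennreal powr_mono2 top_unique)

lemma enn_pow_enn_pow: "enn_pow p (enn_pow q x) = enn_pow (p * q) x"
  by (cases x) (simp_all add: enn_pow_ennreal powr_powr mult.commute)

lemma enn_pow_inverse [simp]:
  "p \<noteq> 0 \<Longrightarrow> enn_pow (1 / p) (enn_pow p x) = x" "p \<noteq> 0 \<Longrightarrow> enn_pow p (enn_pow (1 / p) x) = x"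
  by (simp_all add: enn_pow_enn_pow)

lemma enn_pow_le_iff:
  assumes "0 < p"
  shows "enn_pow p x \<le> enn_pow p y \<longleftrightarrow> x \<le> y"
  using assms enn_pow_mono[of p x y] enn_pow_mono[of "1/p" "enn_pow p x" "enn_pow p y"] by auto

lemma enn_pow_root_le_iff:
  assumes "0 < p"
  shows "enn_pow (1 / p) x \<le> y \<longleftrightarrow> x \<le> enn_pow p y"
  using assms enn_pow_le_iff[of p "enn_pow (1/p) x" y] by simp

text \<open>\<open>enn_pow\<close> fixes both \<open>0\<close> and \<open>top\<close> for every
  exponent, which is compatible with \<open>0 * top = 0\<close>; so powers and roots pass through
  all later products without side conditions.\<close>

lemma enn_pow_mult: "enn_pow p (x * y) = enn_pow p x * enn_pow p y"
proof (cases x)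
  case xr: (real r)
  show ?thesis
  proof (cases y)
    case (real s)
    with xr show ?thesis
      by (simp add: enn_pow_ennreal powr_mult flip: ennreal_mult)
  next
    case top
    with xr show ?thesis by (cases "x = 0") (simp_all add: ennreal_mult_top)
  qed
next
  case top
  then show ?thesis by (cases "y = 0") (simp_all add: ennreal_top_mult)
qed

lemma enn_pow_add: "0 < p \<Longrightarrow> 0 < q \<Longrightarrow> enn_pow (p + q) x = enn_pow p x * enn_pow q x"
  by (cases x) (simp_all add: enn_pow_ennreal powr_add ennreal_mult')

lemma enn_pow_indicator [simp]: "enn_pow p (indicator A x) = indicator A x"
  by (auto simp: indicator_def)

lemma measurable_enn_pow [measurable]: "enn_pow p \<in> borel_measurable borel"
  unfolding enn_pow_def by measurable

lemma ennreal_le_divide_iff: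
  "0 < b \<Longrightarrow> b < top \<Longrightarrow> a \<le> c / b \<longleftrightarrow> a * b \<le> (c::ennreal)"
  by (metis divide_less_ennreal less_irrefl linorder_not_le)

lemma divide_le_ennreal_iff:
  assumes "0 < b" "b < (top::ennreal)" shows "a / b \<le> c \<longleftrightarrow> a \<le> c * b"
proof
  assume "a / b \<le> c"
  then have "a / b * b \<le> c * b" by (rule mult_right_mono) simp
  then show "a \<le> c * b"
    using assms by (simp add: ennreal_divide_times)
next
  assume "a \<le> c * b"
  then show "a / b \<le> c" using assms
    by (metis divide_right_mono_ennreal ennreal_mult_divide_eq order_less_irrefl less_top mult.commute)
qed

text \<open>Clears the root and the division by \<open>\<phi>\<close>. A Morrey bound becomes a
  bound of the mass of each ball by a constant times \<open>\<phi>\<close>, the form that the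
  covering argument propagates.\<close>

lemma morrey_norm_le_iff:
  assumes p: "0 < p" and phi: "\<And>c r. 0 < r \<Longrightarrow> 0 < \<phi> (ball c r)"
  shows "morrey_norm p \<phi> w g \<le> N \<longleftrightarrow>
    (\<forall>c r. 0 < r \<longrightarrow> (\<integral>\<^sup>+x\<in>ball c r. enn_pow p (g x) * ennreal (w x) \<partial>lebesgue)
        \<le> ennreal (\<phi> (ball c r)) * enn_pow p N)"
proof -
  have *: "ennreal (1 / u) * I \<le> L \<longleftrightarrow> I \<le> ennreal u * L" if "0 < u" for u :: real and I L :: ennreal
  proof -
    have "ennreal (1 / u) * I = I / ennreal u"
      using that by (simp add: divide_ennreal_def inverse_ennreal inverse_eq_divide mult.commute)
    then show ?thesis
      using that by (simp add: divide_le_ennreal_iff mult.commute)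
  qed
  show ?thesis
    unfolding morrey_norm_def SUP_le_iff
    using p phi by (auto simp: enn_pow_root_le_iff *)
qed

lemma nn_integral_morrey_le:
  assumes "0 < p" "\<And>c r. 0 < r \<Longrightarrow> 0 < \<phi> (ball c r)" "0 < r"
  shows "(\<integral>\<^sup>+x\<in>ball c r. enn_pow p (g x) * ennreal (w x) \<partial>lebesgue)
        \<le> ennreal (\<phi> (ball c r)) * enn_pow p (morrey_norm p \<phi> w g)"
  using morrey_norm_le_iff[of p \<phi> w g "morrey_norm p \<phi> w g"] assms by auto

lemma emeasure_lebesgue_ball_pos:
  assumes "0 < r"
  shows "0 < emeasure lebesgue (ball c r)" "emeasure lebesgue (ball c r) < top"
  using assms emeasure_lborel_ball_finite[of c r] content_ball_gt_0_iff[of c r]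
  by (auto simp: zero_less_iff_neq_zero measure_def)

lemma emeasure_lebesgue_ball_mult:
  assumes "0 < r" "0 < k"
  shows "emeasure lebesgue (ball c (k * r)) =
    ennreal (k ^ DIM('a)) * emeasure lebesgue (ball (c :: 'a :: euclidean_space) r)"
  using assms by (simp add: emeasure_ball power_mult_distrib mult.left_commute flip: ennreal_mult)

section \<open>Necessity of the condition \<open>A_morrey\<close>\<close>

lemma A_morrey_if_M_bdd_weak:
  assumes p: "1 \<le> p" and phi: "\<And>c r. 0 < r \<Longrightarrow> 0 < \<phi> (ball c r)"
    and M: "M_bdd_weak p \<phi> w"
  shows "A_morrey p \<phi> w"
proof -
  obtain C where C: "\<And>f. f \<in> borel_measurable lebesgue \<Longrightarrow> morrey_norm p \<phi> w (\<lambda>x. ennreal \<bar>f x\<bar>) < \<infinity> \<Longrightarrow>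
      weak_morrey_norm p \<phi> w (hl_max f) \<le> ennreal C * morrey_norm p \<phi> w (\<lambda>x. ennreal \<bar>f x\<bar>)"
    using M unfolding M_bdd_weak_def by blast
  show ?thesis
    unfolding A_morrey_def
  proof (intro exI allI impI)
    fix c :: 'a and r :: real assume r: "0 < r"
    let ?X = "morrey_norm p \<phi> w (\<lambda>x. ennreal (indicator (ball c r) x))"
    have "?X * (\<integral>\<^sup>+ x. ennreal \<bar>f x * indicator (ball c r) x\<bar> \<partial>lebesgue)
        \<le> ennreal C * emeasure lebesgue (ball c r)"
      if f[measurable]: "f \<in> borel_measurable lebesgue" and f1: "morrey_norm p \<phi> w (\<lambda>x. ennreal \<bar>f x\<bar>) \<le> 1"
      for f :: "'a \<Rightarrow> real"
    proof -
      define I where "I = (\<integral>\<^sup>+ y\<in>ball c r. ennreal \<bar>f y\<bar> \<partial>lebesgue)"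
      have I: "I = (\<integral>\<^sup>+ x. ennreal \<bar>f x * indicator (ball c r) x\<bar> \<partial>lebesgue)"
        unfolding I_def by (intro nn_integral_cong) (auto simp: indicator_def)
      have pos: "0 < emeasure lebesgue (ball c r)" "emeasure lebesgue (ball c r) < top"
        using emeasure_lebesgue_ball_pos[OF r] by auto
      have weak: "weak_morrey_norm p \<phi> w (hl_max f) \<le> ennreal C"
      proof -
        have "weak_morrey_norm p \<phi> w (hl_max f) \<le> ennreal C * morrey_norm p \<phi> w (\<lambda>x. ennreal \<bar>f x\<bar>)"
          using f1 by (intro C f) (auto simp: order_le_less_trans)
        also have "\<dots> \<le> ennreal C * 1" by (rule mult_left_mono[OF f1]) simp
        finally show ?thesis by simp
      qed
      \<comment> \<open>Levels are taken strictly below the average because the weak norm is built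
        on strict superlevel sets. The average itself may be infinite, since \<open>f\<close> is not
        known to be locally integrable.\<close>
      have t: "ennreal t * ?X \<le> ennreal C" if t: "0 < t" "ennreal t < I / emeasure lebesgue (ball c r)" for t
      proof -
        have hl: "hl_max f x > ennreal t" if "x \<in> ball c r" for x
        proof -
          have "I / emeasure lebesgue (ball c r) \<le> hl_max f x"
            unfolding hl_max_def I_def using that r by (intro SUP_upper2[of "(c, r)"]) auto
          with t show ?thesis by simp
        qed
        have "?X \<le> ennreal C / ennreal t"
          unfolding morrey_norm_def
        proof (intro SUP_least, clarify)
          fix c' :: 'a and r' :: real assume r': "0 < r'"
          have "(\<integral>\<^sup>+x\<in>ball c' r'. enn_pow p (ennreal (indicator (ball c r) x)) * ennreal (w x) \<partial>lebesgue)
              \<le> wmeas w {x \<in> ball c' r'. hl_max f x > ennreal t}"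
            unfolding wmeas_def ennreal_indicator using hl
            by (intro nn_integral_mono) (auto simp: indicator_def)
          then have "enn_pow (1 / p) (ennreal (1 / \<phi> (ball c' r')) *
              (\<integral>\<^sup>+x\<in>ball c' r'. enn_pow p (ennreal (indicator (ball c r) x)) * ennreal (w x) \<partial>lebesgue))
             \<le> enn_pow (1 / p) (wmeas w {x \<in> ball c' r'. hl_max f x > ennreal t} * ennreal (1 / \<phi> (ball c' r')))"
            using p by (intro enn_pow_mono) (auto simp: mult.commute[of _ "ennreal (1 / _)"] intro: mult_left_mono)
          also have "\<dots> \<le> ennreal C / ennreal t"
          proof -
            have "ennreal t * enn_pow (1 / p) (wmeas w {x \<in> ball c' r'. hl_max f x > ennreal t} * ennreal (1 / \<phi> (ball c' r')))
                \<le> weak_morrey_norm p \<phi> w (hl_max f)"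
              unfolding weak_morrey_norm_def using r' t(1) by (intro SUP_upper2[of "(c', r', t)"]) auto
            with weak show ?thesis
              using t(1) by (simp add: ennreal_le_divide_iff mult.commute)
          qed
          finally show "enn_pow (1 / p) (ennreal (1 / \<phi> (ball c' r')) *
              (\<integral>\<^sup>+x\<in>ball c' r'. enn_pow p (ennreal (indicator (ball c r) x)) * ennreal (w x) \<partial>lebesgue))
             \<le> ennreal C / ennreal t" .
        qed
        then show ?thesis using t(1) by (simp add: ennreal_le_divide_iff mult.commute)
      qed
      have "I / emeasure lebesgue (ball c r) * ?X \<le> ennreal C"
      proof (cases "?X = 0")
        case False
        show ?thesis
        proof (rule ccontr)
          assume "\<not> ?thesis"
          then have less: "ennreal C < I / emeasure lebesgue (ball c r) * ?X" by simp
          \<comment> \<open>The average is exhausted from below by admissible levels: multiplication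
            in \<open>ennreal\<close> commutes with suprema, so a violation at the average already
            occurs at some smaller, finite \<open>s\<close>.\<close>
          then have "\<exists>s. s < I / emeasure lebesgue (ball c r) \<and> ennreal C < s * ?X"
          proof -
            have "I / emeasure lebesgue (ball c r) = (SUP s\<in>{..<I / emeasure lebesgue (ball c r)}. s)"
              by (metis Sup_lessThan image_ident)
            then have "ennreal C < (SUP s\<in>{..<I / emeasure lebesgue (ball c r)}. s * ?X)"
              using less SUP_mult_right_ennreal[of "\<lambda>s. s" "{..<I / emeasure lebesgue (ball c r)}" ?X] by simp
            then show ?thesis by (auto simp: less_SUP_iff)
          qed
          then obtain s where s: "s < I / emeasure lebesgue (ball c r)" "ennreal C < s * ?X" by blast
          then obtain t where "s = ennreal t" "0 \<le> t" by (cases s) auto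
          with s t[of t] show False
            by (cases "t = 0") auto
        qed
      qed auto
      then have "I / emeasure lebesgue (ball c r) * ?X * emeasure lebesgue (ball c r) \<le> ennreal C * emeasure lebesgue (ball c r)"
        by (rule mult_right_mono) simp
      also have "I / emeasure lebesgue (ball c r) * ?X * emeasure lebesgue (ball c r) = ?X * I"
        using pos by (simp add: ennreal_divide_times ennreal_times_divide mult.commute mult.left_commute)
          (metis ennreal_mult_divide_eq mult.commute mult.left_commute order_less_irrefl)
      finally show ?thesis unfolding I .
    qed
    then show "?X * kothe_norm (morrey_norm p \<phi> w) (indicator (ball c r))
        \<le> ennreal C * emeasure lebesgue (ball c r)"
      unfolding kothe_norm_def SUP_mult_left_ennreal by (intro SUP_least) auto
  qed
qed

section \<open>Maximal operators with respect to doubling measures\<close>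

text \<open>One uncentred operator covers \<open>hl_max\<close>, its restriction to local balls, and
  the operators for \<open>w\<close> and for the dual weight. Balls are stored as centre and radius
  because doubling and Vitali's lemma dilate them about the centre.\<close>

definition wmax :: "'a::euclidean_space measure \<Rightarrow> ('a \<times> real) set \<Rightarrow> ('a \<Rightarrow> ennreal) \<Rightarrow> 'a \<Rightarrow> ennreal" where
  "wmax \<mu> F g x = (SUP (c, r) \<in> {(c, r). (c, r) \<in> F \<and> x \<in> ball c r}.
      (\<integral>\<^sup>+ y\<in>ball c r. g y \<partial>\<mu>) / emeasure \<mu> (ball c r))"

lemma hl_max_eq_wmax: "hl_max f = wmax lebesgue {(c, r). 0 < r} (\<lambda>y. ennreal \<bar>f y\<bar>)"
  unfolding hl_max_def wmax_def by (rule ext) simp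

lemma less_wmax_iff:
  "t < wmax \<mu> F g x \<longleftrightarrow>
    (\<exists>c r. (c, r) \<in> F \<and> x \<in> ball c r \<and> t < (\<integral>\<^sup>+ y\<in>ball c r. g y \<partial>\<mu>) / emeasure \<mu> (ball c r))"
  unfolding wmax_def less_SUP_iff by auto

lemma wmax_le_iff:
  "wmax \<mu> F g x \<le> t \<longleftrightarrow>
    (\<forall>c r. (c, r) \<in> F \<and> x \<in> ball c r \<longrightarrow> (\<integral>\<^sup>+ y\<in>ball c r. g y \<partial>\<mu>) / emeasure \<mu> (ball c r) \<le> t)"
  unfolding wmax_def SUP_le_iff by auto

lemma average_le_wmax:
  "(c, r) \<in> F \<Longrightarrow> x \<in> ball c r \<Longrightarrow> (\<integral>\<^sup>+ y\<in>ball c r. g y \<partial>\<mu>) / emeasure \<mu> (ball c r) \<le> wmax \<mu> F g x"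
  using wmax_le_iff[of \<mu> F g x "wmax \<mu> F g x"] by auto

text \<open>As a union of open balls the superlevel set is open, so \<open>wmax\<close> is lower
  semicontinuous and hence Borel measurable for arbitrary \<open>F\<close> and
  \<open>\<mu>\<close>.\<close>

lemma wmax_superlevel:
  "{x. t < wmax \<mu> F g x} =
    (\<Union>(c, r)\<in>{(c, r). (c, r) \<in> F \<and> t < (\<integral>\<^sup>+ y\<in>ball c r. g y \<partial>\<mu>) / emeasure \<mu> (ball c r)}. ball c r)"
  unfolding less_wmax_iff by (auto simp: mem_ball) blast

lemma open_wmax_superlevel: "open {x. t < wmax \<mu> F g x}"
  unfolding wmax_superlevel by auto

lemma wmax_superlevel_lebesgue: "{x. t < wmax \<mu> F g x} \<in> sets lebesgue"
  by (intro sets_completionI_sets lborelD borel_open open_wmax_superlevel)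

lemma borel_measurable_wmax: "wmax \<mu> F g \<in> borel_measurable borel"
  by (rule borel_measurableI_greater) (simp add: open_wmax_superlevel)

lemma borel_measurable_wmax_lebesgue [measurable]:
  "wmax \<mu> F g \<in> borel_measurable (lebesgue :: 'a::euclidean_space measure)"
  using borel_measurable_wmax[of \<mu> F g] by (intro measurable_completion) simp

text \<open>Vitali: disjoint balls chosen among those witnessing level \<open>t\<close> cover the
  superlevel set after fivefold dilation. Doubling pays for the dilation, and disjointness lets the
  integrals of \<open>g\<close> add up. The radius bound \<open>R\<close> feeds Vitali's lemma and
  does not enter the constant.\<close>

lemma wmax_weak_type:
  fixes \<mu> :: "'a::euclidean_space measure"
  assumes sets[measurable_cong]: "sets \<mu> = sets lebesgue" and g[measurable]: "g \<in> borel_measurable lebesgue"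
    and F: "\<And>c r. (c, r) \<in> F \<Longrightarrow> 0 < r \<and> r \<le> R"
    and doubling: "\<And>c r. (c, r) \<in> F \<Longrightarrow> emeasure \<mu> (ball c (5 * r)) \<le> D * emeasure \<mu> (ball c r)"
  shows "t * emeasure \<mu> {x. t < wmax \<mu> F g x} \<le> D * (\<integral>\<^sup>+x. g x \<partial>\<mu>)"
proof -
  define S where "S = {x. t < wmax \<mu> F g x}"
  define K where "K = {(c, r). (c, r) \<in> F \<and> t < (\<integral>\<^sup>+ y\<in>ball c r. g y \<partial>\<mu>) / emeasure \<mu> (ball c r)}"
  have ball[measurable]: "ball c r \<in> sets \<mu>" for c :: 'a and r
    unfolding sets by simp
  have g'[measurable]: "g \<in> borel_measurable \<mu>" by measurable
  have space: "space \<mu> = UNIV" using sets_eq_imp_space_eq[OF sets] by simp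
  have "S \<subseteq> (\<Union>i\<in>K. ball (fst i) (snd i))"
    unfolding S_def K_def wmax_superlevel by auto
  moreover have "0 < snd i \<and> snd i \<le> R" if "i \<in> K" for i
    using F[of "fst i" "snd i"] that by (auto simp: K_def)
  ultimately obtain C where C: "countable C" "C \<subseteq> K"
    and pw: "pairwise (\<lambda>i j. disjnt (ball (fst i) (snd i)) (ball (fst j) (snd j))) C"
    and cov: "S \<subseteq> (\<Union>i\<in>C. ball (fst i) (5 * snd i))"
    by (rule Vitali_covering_lemma_balls) (auto intro: that)
  have disj: "disjoint_family_on (\<lambda>i. ball (fst i) (snd i)) C"
    using pw by (auto simp: disjoint_family_on_def pairwise_def disjnt_def)
  \<comment> \<open>Sums over the countable subfamily are written as \<open>count_space\<close>
    integrals, so that subadditivity follows from exchanging two integrals.\<close>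
  have "t * emeasure \<mu> S \<le> t * (\<integral>\<^sup>+i. emeasure \<mu> (ball (fst i) (5 * snd i)) \<partial>count_space C)"
  proof (rule mult_left_mono)
    have meas: "(\<Union>i\<in>C. ball (fst i) (5 * snd i)) \<in> sets \<mu>"
      using C(1) by (intro sets.countable_UN') auto
    have "emeasure \<mu> S \<le> emeasure \<mu> (\<Union>i\<in>C. ball (fst i) (5 * snd i))"
      by (rule emeasure_mono[OF cov meas])
    also have "\<dots> = (\<integral>\<^sup>+x. indicator (\<Union>i\<in>C. ball (fst i) (5 * snd i)) x \<partial>\<mu>)"
      using meas by simp
    also have "\<dots> \<le> (\<integral>\<^sup>+x. (\<integral>\<^sup>+i. indicator (ball (fst i) (5 * snd i)) x \<partial>count_space C) \<partial>\<mu>)"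
    proof (rule nn_integral_mono)
      fix x
      show "indicator (\<Union>i\<in>C. ball (fst i) (5 * snd i)) x
          \<le> (\<integral>\<^sup>+i. indicator (ball (fst i) (5 * snd i)) x \<partial>count_space C)"
      proof (cases "x \<in> (\<Union>i\<in>C. ball (fst i) (5 * snd i))")
        case True
        then obtain i where i: "i \<in> C" "x \<in> ball (fst i) (5 * snd i)" by auto
        have "1 = (indicator (ball (fst i) (5 * snd i)) x :: ennreal)" using i by simp
        also have "\<dots> \<le> (\<integral>\<^sup>+i. indicator (ball (fst i) (5 * snd i)) x \<partial>count_space C)"
          by (rule nn_integral_ge_point[OF i(1)])
        finally show ?thesis unfolding indicator_simps(1)[OF True] .
      qed simp
    qed
    also have "\<dots> = (\<integral>\<^sup>+i. (\<integral>\<^sup>+x. indicator (ball (fst i) (5 * snd i)) x \<partial>\<mu>) \<partial>count_space C)"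
      by (rule nn_integral_count_space_nn_integral[OF C(1)]) measurable
    also have "\<dots> = (\<integral>\<^sup>+i. emeasure \<mu> (ball (fst i) (5 * snd i)) \<partial>count_space C)"
      by simp
    finally show "emeasure \<mu> S \<le> (\<integral>\<^sup>+i. emeasure \<mu> (ball (fst i) (5 * snd i)) \<partial>count_space C)" .
  qed simp
  also have "\<dots> = (\<integral>\<^sup>+i. t * emeasure \<mu> (ball (fst i) (5 * snd i)) \<partial>count_space C)"
    by (simp add: nn_integral_cmult)
  also have "\<dots> \<le> (\<integral>\<^sup>+i. D * emeasure (density \<mu> g) (ball (fst i) (snd i)) \<partial>count_space C)"
  proof (rule nn_integral_mono)
    fix i assume "i \<in> space (count_space C)"
    then have i: "(fst i, snd i) \<in> F"
      "t < (\<integral>\<^sup>+ y\<in>ball (fst i) (snd i). g y \<partial>\<mu>) / emeasure \<mu> (ball (fst i) (snd i))"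
      using C(2) by (auto simp: K_def)
    let ?B = "ball (fst i) (snd i)"
    have "t * emeasure \<mu> ?B \<le> (\<integral>\<^sup>+ y\<in>?B. g y \<partial>\<mu>)"
    \<comment> \<open>On a null ball the left side vanishes; a ball of infinite measure has average
      \<open>0\<close>, which cannot exceed \<open>t\<close>.\<close>
    proof (cases "emeasure \<mu> ?B = 0 \<or> emeasure \<mu> ?B = top")
      case True
      then show ?thesis using i(2) by auto
    next
      case False
      then have "0 < emeasure \<mu> ?B" "emeasure \<mu> ?B < top"
        by (simp_all add: zero_less_iff_neq_zero top.not_eq_extremum)
      then show ?thesis using ennreal_le_divide_iff less_imp_le[OF i(2)] by blast
    qed
    then have "D * (t * emeasure \<mu> ?B) \<le> D * (\<integral>\<^sup>+ y\<in>?B. g y \<partial>\<mu>)" by (rule mult_left_mono) simp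
    moreover have "t * emeasure \<mu> (ball (fst i) (5 * snd i)) \<le> t * (D * emeasure \<mu> ?B)"
      using doubling[OF i(1)] by (rule mult_left_mono) simp
    ultimately show "t * emeasure \<mu> (ball (fst i) (5 * snd i)) \<le> D * emeasure (density \<mu> g) ?B"
      by (simp add: emeasure_density mult.left_commute)
  qed
  also have "\<dots> = D * (\<integral>\<^sup>+i. emeasure (density \<mu> g) (ball (fst i) (snd i)) \<partial>count_space C)"
    by (simp add: nn_integral_cmult)
  also have "\<dots> = D * emeasure (density \<mu> g) (\<Union>i\<in>C. ball (fst i) (snd i))"
    using emeasure_UN_countable[OF _ C(1) disj, of "density \<mu> g"] by simp
  also have "\<dots> \<le> D * emeasure (density \<mu> g) (space (density \<mu> g))"
    by (intro mult_left_mono emeasure_space) simp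
  also have "\<dots> = D * (\<integral>\<^sup>+x. g x \<partial>\<mu>)"
    by (subst emeasure_density) (auto simp: space sets)
  finally show ?thesis unfolding S_def .
qed

section \<open>Interpolation from weak type to strong type\<close>

lemma enn_pow_layer_cake:
  assumes q: "0 < q"
  shows "enn_pow q y = (\<integral>\<^sup>+t. ennreal (q * t powr (q - 1)) * indicator {t. 0 < t \<and> ennreal t < y} t \<partial>lborel)"
proof -
  have finite_case: "(\<integral>\<^sup>+t. ennreal (q * t powr (q - 1)) * indicator {t. 0 < t \<and> ennreal t < ennreal u} t \<partial>lborel)
      = ennreal (u powr q)" if u: "0 \<le> u" for u
  proof -
    have "((\<lambda>t. q * t powr (q - 1)) has_integral (q * (u powr (q - 1 + 1) / (q - 1 + 1)))) {0..u}"
      using q u by (intro has_integral_mult_right has_integral_powr_from_0) auto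
    then have "((\<lambda>t. q * t powr (q - 1)) has_integral (u powr q)) {0..u}" using q by simp
    then have "(\<integral>\<^sup>+t. ennreal (indicator {0..u} t * (q * t powr (q - 1))) \<partial>lborel) = ennreal (u powr q)"
      using q by (intro nn_integral_has_integral_lebesgue) auto
    also have "(\<integral>\<^sup>+t. ennreal (indicator {0..u} t * (q * t powr (q - 1))) \<partial>lborel) =
       (\<integral>\<^sup>+t. ennreal (q * t powr (q - 1)) * indicator {t. 0 < t \<and> ennreal t < ennreal u} t \<partial>lborel)"
      using AE_lborel_singleton[of u] AE_lborel_singleton[of 0] u
      by (intro nn_integral_cong_AE) (auto elim!: eventually_rev_mp simp: indicator_def ennreal_less_iff)
    finally show ?thesis .
  qed
  show ?thesis
  proof (cases y)
    case (real u)
    then show ?thesis using finite_case[of u] by (simp add: enn_pow_ennreal)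
  next
    case top
    have "(\<integral>\<^sup>+t. ennreal (q * t powr (q - 1)) * indicator {t. 0 < t \<and> ennreal t < top} t \<partial>lborel) = top"
    proof (rule top_unique[THEN iffD1])
      show "top \<le> (\<integral>\<^sup>+t. ennreal (q * t powr (q - 1)) * indicator {t. 0 < t \<and> ennreal t < top} t \<partial>lborel)" (is "_ \<le> ?I")
      proof (rule ccontr)
        assume "\<not> top \<le> ?I"
        then obtain b where b: "?I = ennreal b" "0 \<le> b" by (cases ?I) auto
        \<comment> \<open>Chosen so that \<open>u powr q = b + 1\<close>, which exceeds the supposed
          finite value \<open>b\<close> of the integral.\<close>
        define u where "u = (b + 1) powr (1 / q)"
        have "ennreal (u powr q) \<le> ?I"
          by (subst finite_case[symmetric]) (auto simp: u_def indicator_def intro!: nn_integral_mono)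
        also have "u powr q = b + 1" using q b by (simp add: u_def powr_powr)
        finally show False using b by simp
      qed
    qed
    then show ?thesis using top by simp
  qed
qed

text \<open>Marcinkiewicz interpolation between the weak bound and the trivial bound of averages by
  the supremum. Integrating the level estimate leaves
  \<open>2 * (q / (q - 1)) * 2 powr (q - 1)\<close> times \<open>D\<close>, which is the stated
  constant.\<close>

lemma wmax_strong_type:
  fixes \<mu> :: "'a::euclidean_space measure"
  assumes sets[measurable_cong]: "sets \<mu> = sets lebesgue" and sf: "sigma_finite_measure \<mu>"
    and g[measurable]: "g \<in> borel_measurable lebesgue"
    and F: "\<And>c r. (c, r) \<in> F \<Longrightarrow> 0 < r \<and> r \<le> R"
    and doubling: "\<And>c r. (c, r) \<in> F \<Longrightarrow> emeasure \<mu> (ball c (5 * r)) \<le> D * emeasure \<mu> (ball c r)"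
    and q: "1 < q"
  shows "(\<integral>\<^sup>+x. enn_pow q (wmax \<mu> F g x) \<partial>\<mu>)
    \<le> ennreal (2 powr q * q / (q - 1)) * D * (\<integral>\<^sup>+x. enn_pow q (g x) \<partial>\<mu>)"
proof -
  interpret sigma_finite_measure \<mu> by (rule sf)
  interpret pair_sigma_finite \<mu> "lborel :: real measure" ..
  have space: "space \<mu> = UNIV" using sets_eq_imp_space_eq[OF sets] by simp
  let ?M = "wmax \<mu> F g"
  \<comment> \<open>The part of \<open>g\<close> that is at most \<open>t / 2\<close> adds at most
    \<open>t / 2\<close> to any average, so a point above level \<open>t\<close> for
    \<open>g\<close> is above level \<open>t / 2\<close> for the truncation
    \<open>?h\<close>.\<close>
  have level: "ennreal (t / 2) * emeasure \<mu> {x. ennreal t < ?M x}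
      \<le> D * (\<integral>\<^sup>+x. g x * indicator {x. ennreal t < 2 * g x} x \<partial>\<mu>)" if t: "0 < t" for t :: real
  proof -
    let ?h = "\<lambda>x. g x * indicator {x. ennreal t < 2 * g x} x"
    have "emeasure \<mu> {x. ennreal t < ?M x} \<le> emeasure \<mu> {x. ennreal (t / 2) < wmax \<mu> F ?h x}"
    proof (rule emeasure_mono)
      show "{x. ennreal t < ?M x} \<subseteq> {x. ennreal (t / 2) < wmax \<mu> F ?h x}"
      proof safe
        fix x assume "ennreal t < ?M x"
        then obtain c r where cr: "(c, r) \<in> F" "x \<in> ball c r"
          and less: "ennreal t < (\<integral>\<^sup>+ y\<in>ball c r. g y \<partial>\<mu>) / emeasure \<mu> (ball c r)"
          unfolding less_wmax_iff by blast
        have [measurable]: "ball c r \<in> sets \<mu>" unfolding sets by simp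
        \<comment> \<open>A ball of infinite measure would have average \<open>0\<close>.\<close>
        have fin: "emeasure \<mu> (ball c r) \<noteq> top" using less by auto
        have "(\<integral>\<^sup>+ y\<in>ball c r. g y \<partial>\<mu>) \<le> (\<integral>\<^sup>+ y. ?h y * indicator (ball c r) y + ennreal (t / 2) * indicator (ball c r) y \<partial>\<mu>)"
        proof (intro nn_integral_mono)
          fix y
          have "g y \<le> ennreal (t / 2)" if "\<not> ennreal t < 2 * g y"
            using that t by (cases "g y") (auto simp: ennreal_mult[symmetric] ennreal_less_iff simp flip: ennreal_numeral)
          then show "g y * indicator (ball c r) y \<le> ?h y * indicator (ball c r) y + ennreal (t / 2) * indicator (ball c r) y"
            by (auto simp: indicator_def)
        qed
        also have "\<dots> = (\<integral>\<^sup>+ y\<in>ball c r. ?h y \<partial>\<mu>) + ennreal (t / 2) * emeasure \<mu> (ball c r)"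
          by (subst nn_integral_add) (auto simp: nn_integral_cmult)
        finally have "(\<integral>\<^sup>+ y\<in>ball c r. g y \<partial>\<mu>) / emeasure \<mu> (ball c r)
            \<le> ((\<integral>\<^sup>+ y\<in>ball c r. ?h y \<partial>\<mu>) + ennreal (t / 2) * emeasure \<mu> (ball c r)) / emeasure \<mu> (ball c r)"
          by (rule divide_right_mono_ennreal)
        also have "\<dots> \<le> (\<integral>\<^sup>+ y\<in>ball c r. ?h y \<partial>\<mu>) / emeasure \<mu> (ball c r) + ennreal (t / 2)"
          using fin by (cases "emeasure \<mu> (ball c r) = 0")
            (auto simp: add_divide_distrib_ennreal ennreal_mult_divide_eq)
        finally have le: "(\<integral>\<^sup>+ y\<in>ball c r. g y \<partial>\<mu>) / emeasure \<mu> (ball c r)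
            \<le> (\<integral>\<^sup>+ y\<in>ball c r. ?h y \<partial>\<mu>) / emeasure \<mu> (ball c r) + ennreal (t / 2)" .
        have "ennreal (t / 2) < (\<integral>\<^sup>+ y\<in>ball c r. ?h y \<partial>\<mu>) / emeasure \<mu> (ball c r)"
        proof (rule ccontr)
          assume "\<not> ?thesis"
          then have "(\<integral>\<^sup>+ y\<in>ball c r. ?h y \<partial>\<mu>) / emeasure \<mu> (ball c r) + ennreal (t / 2) \<le> ennreal (t / 2) + ennreal (t / 2)"
            by (intro add_right_mono) simp
          also have "\<dots> = ennreal t" using t by (simp flip: ennreal_plus)
          finally show False using le less by simp
        qed
        then show "ennreal (t / 2) < wmax \<mu> F ?h x"
          unfolding less_wmax_iff using cr by blast
      qed
      show "{x. ennreal (t / 2) < wmax \<mu> F ?h x} \<in> sets \<mu>"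
        unfolding sets by (rule wmax_superlevel_lebesgue)
    qed
    then have "ennreal (t / 2) * emeasure \<mu> {x. ennreal t < ?M x}
        \<le> ennreal (t / 2) * emeasure \<mu> {x. ennreal (t / 2) < wmax \<mu> F ?h x}"
      by (rule mult_left_mono) simp
    also have "\<dots> \<le> D * (\<integral>\<^sup>+x. ?h x \<partial>\<mu>)"
      by (rule wmax_weak_type[OF sets _ F doubling]) auto
    finally show ?thesis .
  qed
  have [measurable]: "?M \<in> borel_measurable \<mu>" "g \<in> borel_measurable \<mu>" by measurable
  have "(\<integral>\<^sup>+x. enn_pow q (?M x) \<partial>\<mu>) =
      (\<integral>\<^sup>+x. (\<integral>\<^sup>+t. ennreal (q * t powr (q - 1)) * indicator {t. 0 < t \<and> ennreal t < ?M x} t \<partial>lborel) \<partial>\<mu>)"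
    using q by (intro nn_integral_cong enn_pow_layer_cake) auto
  also have "\<dots> = (\<integral>\<^sup>+t. (\<integral>\<^sup>+x. ennreal (q * t powr (q - 1)) * indicator {t. 0 < t \<and> ennreal t < ?M x} t \<partial>\<mu>) \<partial>lborel)"
    by (rule Fubini'[symmetric]) measurable
  also have "\<dots> \<le> (\<integral>\<^sup>+t. (\<integral>\<^sup>+x. 2 * D * (g x * (ennreal (q * t powr (q - 2)) * indicator {t. 0 < t \<and> ennreal t < 2 * g x} t)) \<partial>\<mu>) \<partial>lborel)"
  proof (rule nn_integral_mono)
    fix t :: real
    show "(\<integral>\<^sup>+x. ennreal (q * t powr (q - 1)) * indicator {t. 0 < t \<and> ennreal t < ?M x} t \<partial>\<mu>)
       \<le> (\<integral>\<^sup>+x. 2 * D * (g x * (ennreal (q * t powr (q - 2)) * indicator {t. 0 < t \<and> ennreal t < 2 * g x} t)) \<partial>\<mu>)"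
    proof (cases "0 < t")
      case True
      \<comment> \<open>Splits off the factor \<open>t / 2\<close> that the level estimate asks
        for.\<close>
      have pw: "ennreal (q * t powr (q - 1)) = 2 * ennreal (q * t powr (q - 2)) * ennreal (t / 2)"
      proof -
        have "q * t powr (q - 1) = 2 * (q * t powr (q - 2)) * (t / 2)"
          using True powr_add[of t "q - 2" 1] by simp
        also have "ennreal \<dots> = 2 * ennreal (q * t powr (q - 2)) * ennreal (t / 2)"
          using q True by (simp only: ennreal_mult ennreal_numeral mult_nonneg_nonneg zero_le_numeral powr_ge_zero less_imp_le divide_nonneg_nonneg)
        finally show ?thesis .
      qed
      have "(\<integral>\<^sup>+x. ennreal (q * t powr (q - 1)) * indicator {t. 0 < t \<and> ennreal t < ?M x} t \<partial>\<mu>)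
          = (\<integral>\<^sup>+x. ennreal (q * t powr (q - 1)) * indicator {x. ennreal t < ?M x} x \<partial>\<mu>)"
        using True by (intro nn_integral_cong) (auto simp: indicator_def)
      also have "\<dots> = ennreal (q * t powr (q - 1)) * emeasure \<mu> {x. ennreal t < ?M x}"
        by (subst nn_integral_cmult_indicator) (auto simp: sets wmax_superlevel_lebesgue)
      also have "\<dots> = 2 * ennreal (q * t powr (q - 2)) * (ennreal (t / 2) * emeasure \<mu> {x. ennreal t < ?M x})"
        unfolding pw by (simp add: mult.assoc)
      also have "\<dots> \<le> 2 * ennreal (q * t powr (q - 2)) * (D * (\<integral>\<^sup>+x. g x * indicator {x. ennreal t < 2 * g x} x \<partial>\<mu>))"
        by (rule mult_left_mono[OF level[OF True]]) simp
      also have "\<dots> = 2 * D * ennreal (q * t powr (q - 2)) * (\<integral>\<^sup>+x. g x * indicator {x. ennreal t < 2 * g x} x \<partial>\<mu>)"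
        by (simp add: ac_simps)
      also have "\<dots> = (\<integral>\<^sup>+x. 2 * D * ennreal (q * t powr (q - 2)) * (g x * indicator {x. ennreal t < 2 * g x} x) \<partial>\<mu>)"
        by (subst nn_integral_cmult) auto
      also have "\<dots> = (\<integral>\<^sup>+x. 2 * D * (g x * (ennreal (q * t powr (q - 2)) * indicator {t. 0 < t \<and> ennreal t < 2 * g x} t)) \<partial>\<mu>)"
        using True by (intro nn_integral_cong) (auto simp: indicator_def ac_simps)
      finally show ?thesis .
    qed simp
  qed
  also have "\<dots> = (\<integral>\<^sup>+x. (\<integral>\<^sup>+t. 2 * D * (g x * (ennreal (q * t powr (q - 2)) * indicator {t. 0 < t \<and> ennreal t < 2 * g x} t)) \<partial>lborel) \<partial>\<mu>)"
    by (rule Fubini') measurable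
  also have "\<dots> = (\<integral>\<^sup>+x. ennreal (2 powr q * q / (q - 1)) * D * enn_pow q (g x) \<partial>\<mu>)"
  proof (rule nn_integral_cong)
    fix x
    have "(\<integral>\<^sup>+t. 2 * D * (g x * (ennreal (q * t powr (q - 2)) * indicator {t. 0 < t \<and> ennreal t < 2 * g x} t)) \<partial>lborel)
        = (\<integral>\<^sup>+t. 2 * D * g x * ennreal (q / (q - 1)) * (ennreal ((q - 1) * t powr (q - 1 - 1)) * indicator {t. 0 < t \<and> ennreal t < 2 * g x} t) \<partial>lborel)"
    proof (rule nn_integral_cong)
      fix t :: real
      have "ennreal (q * t powr (q - 2)) = ennreal (q / (q - 1)) * ennreal ((q - 1) * t powr (q - 1 - 1))"
        using q by (simp flip: ennreal_mult)
      then show "2 * D * (g x * (ennreal (q * t powr (q - 2)) * indicator {t. 0 < t \<and> ennreal t < 2 * g x} t))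
        = 2 * D * g x * ennreal (q / (q - 1)) * (ennreal ((q - 1) * t powr (q - 1 - 1)) * indicator {t. 0 < t \<and> ennreal t < 2 * g x} t)"
        by (simp add: mult.assoc)
    qed
    \<comment> \<open>The inner integral in \<open>t\<close> is itself a layer cake, with exponent
      \<open>q - 1\<close>, which is positive because \<open>1 < q\<close>.\<close>
    also have "\<dots> = 2 * D * g x * ennreal (q / (q - 1)) * enn_pow (q - 1) (2 * g x)"
      using q by (subst nn_integral_cmult) (auto simp: enn_pow_layer_cake[of "q - 1" "2 * g x"])
    also have "\<dots> = (2 * ennreal (q / (q - 1)) * enn_pow (q - 1) 2) * D * (enn_pow 1 (g x) * enn_pow (q - 1) (g x))"
      by (simp add: enn_pow_mult ac_simps)
    also have "enn_pow 1 (g x) * enn_pow (q - 1) (g x) = enn_pow q (g x)"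
      using q enn_pow_add[of 1 "q - 1" "g x"] by simp
    also have "2 * ennreal (q / (q - 1)) * enn_pow (q - 1) 2 = ennreal (2 powr q * q / (q - 1))"
    proof -
      have "enn_pow (q - 1) 2 = ennreal (2 powr (q - 1))"
        using enn_pow_ennreal[of 2 "q - 1"] by simp
      moreover have "2 powr q = 2 * 2 powr (q - 1)"
        using powr_add[of 2 1 "q - 1"] by simp
      ultimately show ?thesis
        using q by (simp add: ennreal_mult[symmetric] mult.commute mult.left_commute flip: ennreal_numeral)
    qed
    finally show "(\<integral>\<^sup>+t. 2 * D * (g x * (ennreal (q * t powr (q - 2)) * indicator {t. 0 < t \<and> ennreal t < 2 * g x} t)) \<partial>lborel)
        = ennreal (2 powr q * q / (q - 1)) * D * enn_pow q (g x)" .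
  qed
  also have "\<dots> = ennreal (2 powr q * q / (q - 1)) * D * (\<integral>\<^sup>+x. enn_pow q (g x) \<partial>\<mu>)"
    by (rule nn_integral_cmult) measurable
  finally show ?thesis .
qed

section \<open>From local to global balls\<close>

lemma doubling_iterate:
  fixes \<phi> :: "'a::euclidean_space set \<Rightarrow> real"
  assumes "\<And>c r. 0 < r \<Longrightarrow> \<phi> (ball c (2 * r)) \<le> D * \<phi> (ball c r)" "0 \<le> D" "0 < r"
  shows "\<phi> (ball c (2 ^ k * r)) \<le> D ^ k * \<phi> (ball c r)"
proof (induction k)
  case (Suc k)
  have "\<phi> (ball c (2 ^ Suc k * r)) \<le> D * \<phi> (ball c (2 ^ k * r))"
    using assms(1)[of "2 ^ k * r" c] assms(3) by (simp add: mult.assoc)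
  also have "\<dots> \<le> D * (D ^ k * \<phi> (ball c r))"
    by (rule mult_left_mono[OF Suc assms(2)])
  finally show ?case by (simp add: mult.assoc)
qed simp

text \<open>Both inequalities are closed so that, after rescaling, the point lies in a compact
  annulus, where finite subcovers exist.\<close>

lemma dyadic_annulus:
  assumes "0 < d" "d \<le> (1::real)"
  shows "\<exists>j. (1 / 2) ^ Suc j \<le> d \<and> d \<le> (1 / 2) ^ j"
proof -
  obtain n where n: "(1 / 2) ^ n < d" using real_arch_pow_inv[OF assms(1), of "1 / 2"] by auto
  define j where "j = (LEAST j. (1 / 2) ^ Suc j \<le> d)"
  have "(1 / 2) ^ Suc n \<le> (1 / 2 :: real) ^ n" by simp
  then have "(1 / 2) ^ Suc n \<le> d" using n by linarith
  then have j: "(1 / 2) ^ Suc j \<le> d" unfolding j_def by (rule LeastI)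
  moreover have "d \<le> (1 / 2) ^ j"
  proof (cases j)
    case (Suc i)
    then have "\<not> (1 / 2) ^ Suc i \<le> d" using not_less_Least[of i "\<lambda>j. (1 / 2) ^ Suc j \<le> d"] unfolding j_def[symmetric] by simp
    then show ?thesis using Suc by simp
  qed (use assms in simp)
  ultimately show ?thesis by blast
qed

text \<open>An estimate on the balls that are small relative to their distance from \<open>a\<close> spreads to all
  balls: a ball centred at \<open>a\<close> is cut into dyadic annuli, each covered by a fixed number of small
  balls, and by reverse doubling the values of \<open>\<phi>\<close> on these sum to a geometric series.\<close>

lemma local_bound_imp_global_bound:
  fixes \<phi> :: "'a::euclidean_space set \<Rightarrow> real" and a :: 'a
  assumes pos: "\<And>c r. 0 < r \<Longrightarrow> 0 < \<phi> (ball c r)"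
    and doubling: "\<And>c r. 0 < r \<Longrightarrow> \<phi> (ball c (2 * r)) \<le> D * \<phi> (ball c r)"
    and \<delta>: "0 < \<delta>"
    and rev: "\<And>c1 r1 c2 r2. 0 < r1 \<Longrightarrow> 0 < r2 \<Longrightarrow> ball c1 r1 \<subseteq> ball c2 r2 \<Longrightarrow>
        \<phi> (ball c1 r1) / \<phi> (ball c2 r2)
          \<le> C * (measure lebesgue (ball c1 r1) / measure lebesgue (ball c2 r2)) powr \<delta>"
    and \<epsilon>: "0 < \<epsilon>" "\<epsilon> \<le> 1"
  obtains L :: real where "0 \<le> L" "\<And>(\<nu> :: 'a measure) K c r. sets \<nu> = sets lebesgue \<Longrightarrow> emeasure \<nu> {a} = 0 \<Longrightarrow>
      (\<And>c r. 0 < r \<Longrightarrow> r < \<epsilon> * dist c a \<Longrightarrow> emeasure \<nu> (ball c r) \<le> K * ennreal (\<phi> (ball c r))) \<Longrightarrow>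
      0 < r \<Longrightarrow> emeasure \<nu> (ball c r) \<le> ennreal L * K * ennreal (\<phi> (ball c r))"
proof -
  define \<eta> where "\<eta> = DIM('a) * \<delta>"
  have \<eta>: "0 < \<eta>" unfolding \<eta>_def using \<delta> by simp
  define \<theta> where "\<theta> = (1 / 2) powr \<eta>"
  have \<theta>: "0 \<le> \<theta>" "\<theta> < 1" using powr_less_mono2[OF \<eta>, of "1 / 2" 1] by (auto simp: \<theta>_def)
  have D: "0 \<le> D"
    using doubling[of 1 a] pos[of 1 a] pos[of 2 a] by (smt (verit) mult_neg_pos mult_1_right)
  have rev': "\<phi> (ball c1 r1) \<le> \<bar>C\<bar> * (r1 / r2) powr \<eta> * \<phi> (ball c2 r2)"
    if r: "0 < r1" "0 < r2" and sub: "ball c1 r1 \<subseteq> ball c2 r2" for c1 r1 c2 r2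
  proof -
    have "measure lebesgue (ball c1 r1) / measure lebesgue (ball c2 r2) = (r1 / r2) powr DIM('a)"
      using r by (simp add: content_ball powr_realpow power_divide unit_ball_vol_pos[THEN less_imp_neq, symmetric])
    then have "(measure lebesgue (ball c1 r1) / measure lebesgue (ball c2 r2)) powr \<delta> = (r1 / r2) powr \<eta>"
      by (simp add: powr_powr \<eta>_def)
    then have "\<phi> (ball c1 r1) / \<phi> (ball c2 r2) \<le> C * (r1 / r2) powr \<eta>"
      using rev[OF r sub] by simp
    also have "\<dots> \<le> \<bar>C\<bar> * (r1 / r2) powr \<eta>" by (intro mult_right_mono) auto
    finally show ?thesis using pos[OF r(2), of c2] by (simp add: pos_divide_le_eq)
  qed
  \<comment> \<open>Model annulus: by compactness finitely many balls of radius
    \<open>\<epsilon> / 4\<close> centred in it cover it. Rescaling by \<open>s j\<close> covers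
    every dyadic annulus with the same number \<open>card Y\<close> of balls.\<close>
  define A :: "'a set" where "A = cball 0 1 - ball 0 (1 / 2)"
  have "compact A" unfolding A_def by (intro compact_diff) auto
  moreover have "A \<subseteq> (\<Union>y\<in>A. ball y (\<epsilon> / 4))" using \<epsilon> by force
  ultimately obtain Y where Y: "Y \<subseteq> A" "finite Y" "A \<subseteq> (\<Union>y\<in>Y. ball y (\<epsilon> / 4))"
    using compactE_image[of A A "\<lambda>y. ball y (\<epsilon> / 4)"] by (metis open_ball)
  \<comment> \<open>\<open>card Y\<close> balls per annulus, \<open>\<bar>C\<bar>\<close> from
    reverse doubling, \<open>D\<close> for passing from \<open>ball a (2 * R)\<close> back to
    \<open>ball a R\<close>, and the sum of the geometric series.\<close>
  define L1 where "L1 = card Y * (\<bar>C\<bar> * D) / (1 - \<theta>)"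
  have L1: "0 \<le> L1" unfolding L1_def using \<theta> D by simp
  \<comment> \<open>Large enough that the ball around \<open>a\<close> of radius
    \<open>r * (1 + 1 / \<epsilon>)\<close> fits into \<open>ball c (2 ^ k * r)\<close> when the
    centres are at most \<open>r / \<epsilon>\<close> apart.\<close>
  obtain k where k: "1 + 2 / \<epsilon> < 2 ^ k" using real_arch_pow[of 2 "1 + 2 / \<epsilon>"] by auto
  \<comment> \<open>The value \<open>1\<close> serves the balls that are already small, the other
    term all remaining ones. \<open>L\<close> is fixed before \<open>\<nu>\<close> and
    \<open>K\<close>, hence it will be uniform in \<open>f\<close> and in the level
    \<open>t\<close>.\<close>
  define L where "L = max 1 (L1 * (\<bar>C\<bar> * D ^ k))"
  show ?thesis
  proof (rule that[of L])
    show "0 \<le> L" by (simp add: L_def)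
    fix \<nu> :: "'a measure" and K :: ennreal and c :: 'a and r :: real
    assume sets: "sets \<nu> = sets lebesgue" and a0: "emeasure \<nu> {a} = 0"
      and loc: "\<And>c r. 0 < r \<Longrightarrow> r < \<epsilon> * dist c a \<Longrightarrow> emeasure \<nu> (ball c r) \<le> K * ennreal (\<phi> (ball c r))"
      and r: "0 < r"
    have ball: "ball c r \<in> sets \<nu>" for c :: 'a and r unfolding sets by simp
    have centred: "emeasure \<nu> (ball a R) \<le> ennreal L1 * K * ennreal (\<phi> (ball a R))" if R: "0 < R" for R
    proof -
      define s where "s j = (1 / 2) ^ j * R" for j :: nat
      have s: "0 < s j" "s j \<le> R" for j using R by (auto simp: s_def power_le_one)
      define B where "B j y = ball (a + s j *\<^sub>R y) (s j * (\<epsilon> / 4))" for j y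
      \<comment> \<open>The annuli miss only the centre \<open>a\<close>, which is why
        \<open>\<nu>\<close> must not charge this point.\<close>
      have cover: "ball a R \<subseteq> {a} \<union> (\<Union>j. \<Union>y\<in>Y. B j y)"
      proof
        fix x assume x: "x \<in> ball a R"
        show "x \<in> {a} \<union> (\<Union>j. \<Union>y\<in>Y. B j y)"
        proof (cases "x = a")
          case False
          then have "0 < norm (x - a) / R" "norm (x - a) / R \<le> 1"
            using x R by (auto simp: dist_norm norm_minus_commute)
          then obtain j where j: "(1 / 2) ^ Suc j \<le> norm (x - a) / R" "norm (x - a) / R \<le> (1 / 2) ^ j"
            using dyadic_annulus by blast
          define z where "z = (x - a) /\<^sub>R s j"
          have xz: "x = a + s j *\<^sub>R z" using s[of j] by (simp add: z_def)
          have "norm (x - a) = s j * norm z" using s[of j] by (simp add: z_def)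
          moreover have "s j * (1 / 2) \<le> norm (x - a)" "norm (x - a) \<le> s j * 1"
            using j R by (auto simp: s_def field_simps)
          ultimately have "1 / 2 \<le> norm z" "norm z \<le> 1"
            using s[of j] by (simp_all only: mult_le_cancel_left_pos)
          then have "z \<in> A" by (simp add: A_def)
          then obtain y where y: "y \<in> Y" "dist y z < \<epsilon> / 4" using Y(3) by auto
          have "dist (a + s j *\<^sub>R y) x = s j * dist y z"
            unfolding xz using s[of j] by (simp add: dist_norm flip: scaleR_diff_right)
          also have "\<dots> < s j * (\<epsilon> / 4)" using y s[of j] by simp
          finally have "x \<in> B j y" by (simp add: B_def)
          then show ?thesis using y by blast
        qed simp
      qed
      have bound: "emeasure \<nu> (B j y) \<le> K * ennreal (\<bar>C\<bar> * D * \<phi> (ball a R)) * ennreal (\<theta> ^ j)" if y: "y \<in> Y" for j y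
      proof -
        have ny: "1 / 2 \<le> norm y" "norm y \<le> 1" using y Y(1) by (auto simp: A_def)
        have sy: "s j * norm y \<le> s j" "s j / 2 \<le> s j * norm y" using s[of j] ny
          by (auto simp: mult_left_le)
        \<comment> \<open>The centre is at distance at least \<open>s j / 2\<close> from
          \<open>a\<close>, so a radius of \<open>s j * (\<epsilon> / 4)\<close> is small enough for
          \<open>loc\<close>.\<close>
        have "s j * (\<epsilon> / 4) < \<epsilon> * (s j / 2)" using s[of j] \<epsilon> by simp
        also have "\<dots> \<le> \<epsilon> * (s j * norm y)" using sy \<epsilon> by (intro mult_left_mono) auto
        also have "s j * norm y = dist (a + s j *\<^sub>R y) a" using s[of j] by (simp add: dist_norm)
        finally have "emeasure \<nu> (B j y) \<le> K * ennreal (\<phi> (B j y))"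
          unfolding B_def using s[of j] \<epsilon> by (intro loc) auto
        also have "\<dots> \<le> K * (ennreal (\<bar>C\<bar> * D * \<phi> (ball a R)) * ennreal (\<theta> ^ j))"
        proof (rule mult_left_mono)
          have se: "s j * (\<epsilon> / 4) \<le> s j" using s[of j] \<epsilon> by simp
          have "B j y \<subseteq> ball a (2 * R)"
          proof
            fix x assume "x \<in> B j y"
            then have "dist (a + s j *\<^sub>R y) x < s j" using se by (simp add: B_def)
            moreover have "dist a (a + s j *\<^sub>R y) \<le> s j" using sy s[of j] by (simp add: dist_norm)
            moreover have "dist a x \<le> dist a (a + s j *\<^sub>R y) + dist (a + s j *\<^sub>R y) x" by (rule dist_triangle)
            ultimately show "x \<in> ball a (2 * R)" using s[of j] by simp
          qed
          then have "\<phi> (B j y) \<le> \<bar>C\<bar> * (s j * (\<epsilon> / 4) / (2 * R)) powr \<eta> * \<phi> (ball a (2 * R))"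
            unfolding B_def using s[of j] \<epsilon> R by (intro rev') auto
          also have "\<dots> \<le> \<bar>C\<bar> * \<theta> ^ j * (D * \<phi> (ball a R))"
          proof (intro mult_mono mult_left_mono doubling R)
            have "(s j * (\<epsilon> / 4) / (2 * R)) powr \<eta> \<le> ((1 / 2) ^ j) powr \<eta>"
              using R s[of j] \<epsilon> \<eta> by (intro powr_mono2) (auto simp: s_def field_simps)
            also have "\<dots> = \<theta> ^ j"
              by (simp add: \<theta>_def powr_realpow[symmetric] powr_powr powr_power mult.commute)
            finally show "(s j * (\<epsilon> / 4) / (2 * R)) powr \<eta> \<le> \<theta> ^ j" .
            show "0 \<le> \<phi> (ball a (2 * R))" using pos[of "2 * R" a] R by simp
          qed (use \<theta> in auto)
          also have "\<dots> = \<bar>C\<bar> * D * \<phi> (ball a R) * \<theta> ^ j" by simp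
          finally show "ennreal (\<phi> (B j y)) \<le> ennreal (\<bar>C\<bar> * D * \<phi> (ball a R)) * ennreal (\<theta> ^ j)"
            using \<theta> D pos[OF R, of a] by (simp add: ennreal_leI flip: ennreal_mult)
        qed simp
        finally show ?thesis by (simp add: mult.assoc)
      qed
      have Bm: "B j y \<in> sets \<nu>" for j y unfolding B_def by (rule ball)
      have UBm: "(\<Union>y\<in>Y. B j y) \<in> sets \<nu>" for j using Y(2) Bm by auto
      have am: "{a} \<in> sets \<nu>" unfolding sets by simp
      have "emeasure \<nu> (ball a R) \<le> emeasure \<nu> ({a} \<union> (\<Union>j. \<Union>y\<in>Y. B j y))"
        using UBm am by (intro emeasure_mono cover sets.Un sets.countable_UN) auto
      also have "\<dots> \<le> emeasure \<nu> {a} + emeasure \<nu> (\<Union>j. \<Union>y\<in>Y. B j y)"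
        using UBm am by (intro emeasure_subadditive) auto
      also have "\<dots> = emeasure \<nu> (\<Union>j. \<Union>y\<in>Y. B j y)" by (simp add: a0)
      also have "\<dots> \<le> (\<Sum>j. emeasure \<nu> (\<Union>y\<in>Y. B j y))"
        using UBm by (intro emeasure_subadditive_countably) auto
      also have "\<dots> \<le> (\<Sum>j. of_nat (card Y) * (K * ennreal (\<bar>C\<bar> * D * \<phi> (ball a R))) * ennreal (\<theta> ^ j))"
      proof (intro suminf_le summableI)
        fix j
        have "emeasure \<nu> (\<Union>y\<in>Y. B j y) \<le> (\<Sum>y\<in>Y. emeasure \<nu> (B j y))"
          using Y(2) Bm by (intro emeasure_subadditive_finite) auto
        also have "\<dots> \<le> of_nat (card Y) * (K * ennreal (\<bar>C\<bar> * D * \<phi> (ball a R)) * ennreal (\<theta> ^ j))"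
          by (rule sum_bounded_above[OF bound])
        finally show "emeasure \<nu> (\<Union>y\<in>Y. B j y) \<le> of_nat (card Y) * (K * ennreal (\<bar>C\<bar> * D * \<phi> (ball a R))) * ennreal (\<theta> ^ j)"
          by (simp add: mult.assoc)
      qed
      also have "\<dots> = of_nat (card Y) * (K * ennreal (\<bar>C\<bar> * D * \<phi> (ball a R))) * (\<Sum>j. ennreal (\<theta> ^ j))"
        by (rule ennreal_suminf_cmult)
      also have "(\<Sum>j. ennreal (\<theta> ^ j)) = ennreal (1 / (1 - \<theta>))"
        using \<theta> geometric_sums[of \<theta>] by (intro suminf_ennreal_eq) auto
      also have "of_nat (card Y) * (K * ennreal (\<bar>C\<bar> * D * \<phi> (ball a R))) * ennreal (1 / (1 - \<theta>))
          = K * (ennreal (card Y) * ennreal (\<bar>C\<bar> * D * \<phi> (ball a R)) * ennreal (1 / (1 - \<theta>)))"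
        by (simp add: ac_simps ennreal_of_nat_eq_real_of_nat)
      also have "ennreal (card Y) * ennreal (\<bar>C\<bar> * D * \<phi> (ball a R)) * ennreal (1 / (1 - \<theta>))
          = ennreal (L1 * \<phi> (ball a R))"
        using \<theta> D pos[OF R, of a] by (simp add: L1_def flip: ennreal_mult)
      also have "\<dots> = ennreal L1 * ennreal (\<phi> (ball a R))"
        using L1 by (rule ennreal_mult')
      finally show ?thesis by (simp add: ac_simps)
    qed
    show "emeasure \<nu> (ball c r) \<le> ennreal L * K * ennreal (\<phi> (ball c r))"
    proof (cases "r < \<epsilon> * dist c a")
      case True
      have "emeasure \<nu> (ball c r) \<le> 1 * (K * ennreal (\<phi> (ball c r)))" using loc[OF r True] by simp
      also have "\<dots> \<le> ennreal L * (K * ennreal (\<phi> (ball c r)))"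
        by (intro mult_right_mono) (auto simp: L_def)
      finally show ?thesis by (simp add: mult.assoc)
    next
      case False
      \<comment> \<open>A ball that is not small has its centre within \<open>r / \<epsilon>\<close>
        of \<open>a\<close>, hence is contained in a ball of comparable size centred at
        \<open>a\<close>.\<close>
      define R where "R = r * (1 + 1 / \<epsilon>)"
      have d: "dist c a \<le> r * (1 / \<epsilon>)" using False \<epsilon> by (simp add: field_simps)
      have R: "0 < R" unfolding R_def using r \<epsilon> by (simp add: add_pos_pos)
      have sub1: "ball c r \<subseteq> ball a R"
      proof
        fix x assume "x \<in> ball c r"
        then have "dist a x < r * (1 / \<epsilon>) + r" using d dist_triangle[of a x c] by (simp add: dist_commute)
        then show "x \<in> ball a R" by (simp add: R_def algebra_simps)
      qed
      have Rk: "r * (1 / \<epsilon>) + R \<le> 2 ^ k * r"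
        using mult_left_mono[OF less_imp_le[OF k], of r] r by (simp add: R_def algebra_simps)
      have sub2: "ball a R \<subseteq> ball c (2 ^ k * r)"
      proof
        fix x assume "x \<in> ball a R"
        then have "dist c x < r * (1 / \<epsilon>) + R" using d dist_triangle[of c x a] by simp
        then show "x \<in> ball c (2 ^ k * r)" using Rk by simp
      qed
      have Rle: "R \<le> 2 ^ k * r" using Rk r \<epsilon> by (smt (verit) divide_nonneg_nonneg mult_nonneg_nonneg)
      have "\<phi> (ball a R) \<le> \<bar>C\<bar> * (R / (2 ^ k * r)) powr \<eta> * \<phi> (ball c (2 ^ k * r))"
        using R r sub2 by (intro rev') auto
      also have "\<dots> \<le> \<bar>C\<bar> * 1 * (D ^ k * \<phi> (ball c r))"
      proof (intro mult_mono mult_left_mono doubling_iterate doubling r D)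
        show "(R / (2 ^ k * r)) powr \<eta> \<le> 1" using R r \<eta> Rle by (intro powr_le1) auto
        show "0 \<le> \<phi> (ball c (2 ^ k * r))" using pos[of "2 ^ k * r" c] r by simp
      qed auto
      finally have \<phi>R: "\<phi> (ball a R) \<le> \<bar>C\<bar> * D ^ k * \<phi> (ball c r)" by simp
      have "emeasure \<nu> (ball c r) \<le> emeasure \<nu> (ball a R)" by (rule emeasure_mono[OF sub1 ball])
      also have "\<dots> \<le> ennreal L1 * K * ennreal (\<phi> (ball a R))" by (rule centred[OF R])
      also have "\<dots> \<le> ennreal L1 * K * ennreal (\<bar>C\<bar> * D ^ k * \<phi> (ball c r))"
        using \<phi>R by (intro mult_left_mono ennreal_leI) auto
      also have "\<dots> = ennreal (L1 * (\<bar>C\<bar> * D ^ k)) * K * ennreal (\<phi> (ball c r))"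
        using L1 D pos[OF r, of c] by (simp add: ennreal_mult ac_simps)
      also have "\<dots> \<le> ennreal L * K * ennreal (\<phi> (ball c r))"
        by (intro mult_right_mono ennreal_leI) (auto simp: L_def)
      finally show ?thesis .
    qed
  qed
qed

section \<open>Local Muckenhoupt weights\<close>

lemma distr_lebesgue_translation:
  "distr lebesgue lebesgue (\<lambda>x. x + a) = (lebesgue :: 'a::euclidean_space measure)"
    and measurable_lebesgue_translation: "(\<lambda>x. x + a) \<in> (lebesgue :: 'a measure) \<rightarrow>\<^sub>M lebesgue"
proof -
  have *: "(\<lambda>x::'a. a + (\<Sum>j\<in>Basis. (1 * (x \<bullet> j)) *\<^sub>R j)) = (\<lambda>x. x + a)"
    by (simp add: euclidean_representation add.commute)
  show "distr lebesgue lebesgue (\<lambda>x. x + a) = (lebesgue :: 'a measure)"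
    using lebesgue_affine_euclidean[of "\<lambda>_. 1" a] unfolding * by (simp add: density_1)
  show "(\<lambda>x. x + a) \<in> (lebesgue :: 'a measure) \<rightarrow>\<^sub>M lebesgue"
    using lebesgue_affine_measurable[of "\<lambda>_. 1" a] unfolding * by simp
qed

lemma nn_integral_lebesgue_translation:
  fixes a :: "'a::euclidean_space"
  assumes "f \<in> borel_measurable lebesgue"
  shows "(\<integral>\<^sup>+x. f (x + a) \<partial>lebesgue) = (\<integral>\<^sup>+x. f x \<partial>lebesgue)"
  using nn_integral_distr[OF measurable_lebesgue_translation[of a], of f] assms
  unfolding distr_lebesgue_translation by simp

lemma AE_lebesgue_translation:
  fixes a :: "'a::euclidean_space"
  assumes "AE x in lebesgue. P (x + a)" "{x. P x} \<in> sets lebesgue"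
  shows "AE x in lebesgue. P x"
  using AE_distr_iff[OF measurable_lebesgue_translation[of a], of P] assms
  unfolding distr_lebesgue_translation by simp

lemma set_nn_integral_ball_translation:
  fixes a :: "'a::euclidean_space"
  assumes [measurable]: "f \<in> borel_measurable lebesgue"
  shows "(\<integral>\<^sup>+x\<in>ball (c - a) r. f (x + a) \<partial>lebesgue) = (\<integral>\<^sup>+x\<in>ball c r. f x \<partial>lebesgue)"
proof -
  have [measurable]: "ball c r \<in> sets lebesgue" by simp
  have "dist (c - a) x = dist c (x + a)" for x by (simp add: dist_norm algebra_simps)
  then have "(\<integral>\<^sup>+x\<in>ball (c - a) r. f (x + a) \<partial>lebesgue)
      = (\<integral>\<^sup>+x. (\<lambda>x. f x * indicator (ball c r) x) (x + a) \<partial>lebesgue)"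
    by (intro nn_integral_cong) (auto simp: indicator_def)
  also have "\<dots> = (\<integral>\<^sup>+x\<in>ball c r. f x \<partial>lebesgue)"
    by (rule nn_integral_lebesgue_translation) measurable
  finally show ?thesis .
qed

lemma emeasure_lebesgue_ball_translation:
  "emeasure lebesgue (ball (c - a) r) = emeasure lebesgue (ball (c :: 'a::euclidean_space) r)"
  by (cases "0 \<le> r") (simp_all add: emeasure_ball ball_empty)

text \<open>Provides the sigma-finiteness behind the exchange of integrals in
  \<open>wmax_strong_type\<close>; a real-valued density is finite everywhere.\<close>

lemma sigma_finite_density_lebesgue:
  fixes f :: "'a::euclidean_space \<Rightarrow> real"
  assumes [measurable]: "f \<in> borel_measurable lebesgue"
  shows "sigma_finite_measure (density lebesgue (\<lambda>x. ennreal (f x)))"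
proof -
  interpret sigma_finite_measure "lebesgue :: 'a measure"
  proof
    have "range (\<lambda>n::nat. ball (0::'a) (real n)) \<subseteq> sets lebesgue" by auto
    moreover have "(\<Union>n::nat. ball (0::'a) (real n)) = space lebesgue"
      using reals_Archimedean2 by auto
    moreover have "emeasure lebesgue (ball (0::'a) (real n)) \<noteq> \<infinity>" for n :: nat
      by (simp add: emeasure_ball)
    ultimately show "\<exists>A. countable A \<and> A \<subseteq> sets (lebesgue :: 'a measure) \<and> \<Union> A = space lebesgue \<and>
        (\<forall>a\<in>A. emeasure lebesgue a \<noteq> \<infinity>)"
      by (intro exI[of _ "range (\<lambda>n::nat. ball (0::'a) (real n))"]) auto
  qed
  show ?thesis by (subst sigma_finite_iff_density_finite) auto
qed

section \<open>Weighted measures and the dual weight\<close>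

abbreviation wmeasure :: "('a::euclidean_space \<Rightarrow> real) \<Rightarrow> 'a measure" where
  "wmeasure w \<equiv> density lebesgue (\<lambda>x. ennreal (w x))"

lemma wmeas_eq_emeasure:
  "w \<in> borel_measurable lebesgue \<Longrightarrow> E \<in> sets lebesgue \<Longrightarrow> wmeas w E = emeasure (wmeasure w) E"
  by (simp add: wmeas_def emeasure_density)

lemma weight_ball_finite:
  assumes "weight w" shows "emeasure (wmeasure w) (ball c r) < top"
proof -
  have w[measurable]: "w \<in> borel_measurable lebesgue" and w0: "\<And>x. 0 \<le> w x"
    and int: "set_integrable lebesgue (cball c r) w"
    using assms by (auto simp: weight_def)
  have "emeasure (wmeasure w) (ball c r) \<le> emeasure (wmeasure w) (cball c r)"
    by (intro emeasure_mono) auto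
  also have "\<dots> = (\<integral>\<^sup>+x. ennreal (norm (indicator (cball c r) x *\<^sub>R w x)) \<partial>lebesgue)"
    using w0 by (subst emeasure_density) (auto intro!: nn_integral_cong simp: indicator_def)
  also have "\<dots> < top"
    using int unfolding set_integrable_def integrable_iff_bounded by simp
  finally show ?thesis .
qed

lemma borel_measurable_dual_weight:
  fixes w :: "'a::euclidean_space \<Rightarrow> real"
  assumes wm[measurable]: "w \<in> borel_measurable lebesgue"
  shows "(\<lambda>x. if w x = 0 then \<infinity> else ennreal (w x powr b)) \<in> borel_measurable lebesgue"
proof -
  have "{x \<in> space lebesgue. w x = 0} \<in> sets lebesgue"
    using measurable_sets[OF wm, of "{0}"] by (simp add: vimage_def)
  then show ?thesis by (intro measurable_If) auto
qed

text \<open>Hoelder's inequality for a power of \<open>w\<close> times its reciprocal, obtained from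
  Young's inequality applied pointwise to both weights normalised by their mass on \<open>B\<close>:
  the powers of \<open>w\<close> cancel and only \<open>1 / G\<close> remains.\<close>

lemma emeasure_le_dual_weights:
  fixes w :: "'a::euclidean_space \<Rightarrow> real"
  assumes [measurable]: "w \<in> borel_measurable lebesgue" and p: "1 < p"
    and [measurable]: "B \<in> sets lebesgue"
    and pos: "AE x in lebesgue. x \<in> B \<longrightarrow> 0 < w x"
    and A: "emeasure (wmeasure w) B = ennreal A" "0 < A"
    and A': "emeasure (wmeasure (\<lambda>x. w x powr (1 - p / (p - 1)))) B = ennreal A'" "0 < A'"
  shows "emeasure lebesgue B \<le> ennreal (A powr (1 / p) * A' powr (1 - 1 / p))"
proof -
  let ?s = "\<lambda>x. w x powr (1 - p / (p - 1))"
  define G where "G = A powr (1 / p) * A' powr (1 - 1 / p)"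
  have "emeasure lebesgue B = (\<integral>\<^sup>+x. indicator B x \<partial>lebesgue)" by simp
  also have "\<dots> \<le> (\<integral>\<^sup>+x. ennreal (G / (p * A)) * (ennreal (w x) * indicator B x)
      + ennreal (G * (1 - 1 / p) / A') * (ennreal (?s x) * indicator B x) \<partial>lebesgue)"
  proof (rule nn_integral_mono_AE, rule AE_mp[OF pos], rule AE_I2, rule impI)
    fix x assume x: "x \<in> B \<longrightarrow> 0 < w x"
    show "indicator B x \<le> ennreal (G / (p * A)) * (ennreal (w x) * indicator B x)
      + ennreal (G * (1 - 1 / p) / A') * (ennreal (?s x) * indicator B x)"
    proof (cases "x \<in> B")
      case True
      with x have w: "0 < w x" by simp
      have "(w x / A) powr (1 / p) * (?s x / A') powr (1 - 1 / p) \<le> (1 / p) * (w x / A) + (1 - 1 / p) * (?s x / A')"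
        using p w A A' by (intro Youngs_inequality_0) auto
      also have "(w x / A) powr (1 / p) * (?s x / A') powr (1 - 1 / p)
          = w x powr (1 / p + (1 - p / (p - 1)) * (1 - 1 / p)) / G"
        using w A A' by (simp add: G_def powr_divide powr_powr powr_add)
      also have "1 / p + (1 - p / (p - 1)) * (1 - 1 / p) = 0" using p by (simp add: field_simps)
      finally have "1 / G \<le> (1 / p) * (w x / A) + (1 - 1 / p) * (?s x / A')" using w by simp
      moreover have G: "0 < G" using A A' by (simp add: G_def)
      ultimately have "1 \<le> G * ((1 / p) * (w x / A) + (1 - 1 / p) * (?s x / A'))"
        by (simp add: pos_divide_le_eq mult.commute)
      also have "\<dots> = G / (p * A) * w x + G * (1 - 1 / p) / A' * ?s x"
        by (simp add: field_simps)
      finally have "ennreal 1 \<le> ennreal (G / (p * A) * w x + G * (1 - 1 / p) / A' * ?s x)"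
        by (rule ennreal_leI)
      also have "\<dots> = ennreal (G / (p * A)) * ennreal (w x) + ennreal (G * (1 - 1 / p) / A') * ennreal (?s x)"
        using p w G A A' by (subst ennreal_plus) (auto simp flip: ennreal_mult)
      finally show ?thesis using True by simp
    qed simp
  qed
  also have "\<dots> = ennreal (G / (p * A)) * ennreal A + ennreal (G * (1 - 1 / p) / A') * ennreal A'"
    using A A' by (subst nn_integral_add) (simp_all add: nn_integral_cmult emeasure_density)
  also have "\<dots> = ennreal (G / (p * A) * A + G * (1 - 1 / p) / A' * A')"
    using p A A' by (subst ennreal_plus) (auto simp: G_def simp flip: ennreal_mult)
  also have "G / (p * A) * A + G * (1 - 1 / p) / A' * A' = G"
    using p A A' by (simp add: field_simps)
  finally show ?thesis unfolding G_def .
qed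

text \<open>What the condition yields on one ball B of positive \<open>w\<close>-mass: a two-sided
  comparison of |B|^p with w(B) S(B)^(p-1). The measure \<open>S\<close> has density
  \<open>0\<close> where \<open>w\<close> vanishes, since \<open>0 powr _ = 0\<close>, while the
  condition puts \<open>\<infinity>\<close> there; positivity of \<open>w\<close> almost everywhere
  on the ball reconciles the two.\<close>

lemma A_p_ball:
  fixes w :: "'a::euclidean_space \<Rightarrow> real" and p :: real
  defines "S \<equiv> wmeasure (\<lambda>x. w x powr (1 - p / (p - 1)))"
  assumes w: "weight w" and p: "1 < p" and r: "0 < r" and W0: "0 < emeasure (wmeasure w) (ball c r)"
    and Ap: "enn_pow (1 / p) (wmeas w (ball c r)) * enn_pow (1 - 1 / p)
        (\<integral>\<^sup>+ x\<in>ball c r. (if w x = 0 then \<infinity> else ennreal (w x powr (1 - p / (p - 1)))) \<partial>lebesgue)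
      \<le> ennreal C * emeasure lebesgue (ball c r)"
  shows "AE x in lebesgue. x \<in> ball c r \<longrightarrow> 0 < w x"
    and "0 < emeasure S (ball c r)" and "emeasure S (ball c r) < top"
    and "emeasure (wmeasure w) (ball c r) * enn_pow (p - 1) (emeasure S (ball c r))
      \<le> enn_pow p (ennreal C) * enn_pow p (emeasure lebesgue (ball c r))"
    and "enn_pow p (emeasure lebesgue (ball c r))
      \<le> emeasure (wmeasure w) (ball c r) * enn_pow (p - 1) (emeasure S (ball c r))"
proof -
  let ?B = "ball c r" and ?W = "wmeasure w"
  let ?s = "\<lambda>x. w x powr (1 - p / (p - 1))"
  have [measurable]: "ball c r \<in> sets lebesgue" by simp
  have wm[measurable]: "w \<in> borel_measurable lebesgue" and w0: "\<And>x. 0 \<le> w x"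
    using w by (auto simp: weight_def)
  define T where "T = (\<integral>\<^sup>+ x\<in>?B. (if w x = 0 then \<infinity> else ennreal (?s x)) \<partial>lebesgue)"
  \<comment> \<open>The condition raised to the power \<open>p\<close>, with
    \<open>p * (1 - 1 / p) = p - 1\<close>.\<close>
  have WT: "emeasure ?W ?B * enn_pow (p - 1) T \<le> enn_pow p (ennreal C) * enn_pow p (emeasure lebesgue ?B)"
  proof -
    have "enn_pow p (enn_pow (1 / p) (emeasure ?W ?B) * enn_pow (1 - 1 / p) T)
        \<le> enn_pow p (ennreal C * emeasure lebesgue ?B)"
      using Ap p unfolding T_def by (intro enn_pow_mono) (auto simp: wmeas_eq_emeasure)
    also have "enn_pow p (enn_pow (1 / p) (emeasure ?W ?B) * enn_pow (1 - 1 / p) T)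
        = emeasure ?W ?B * enn_pow (p - 1) T"
      using p by (simp add: enn_pow_mult enn_pow_enn_pow right_diff_distrib)
    finally show ?thesis by (simp add: enn_pow_mult)
  qed
  have "enn_pow p (ennreal C) * enn_pow p (emeasure lebesgue ?B) < top"
    using emeasure_lebesgue_ball_pos[OF r, of c]
    by (simp add: ennreal_mult_eq_top_iff flip: top.not_eq_extremum)
  \<comment> \<open>Positive mass turns \<open>T = top\<close> into an infinite left side; with zero
    mass the product would be \<open>0 * top = 0\<close> and give nothing.\<close>
  then have T: "T < top" using WT W0
    by (metis enn_pow_eq_top_iff ennreal_top_mult_left order.strict_trans1 less_irrefl top.not_eq_extremum)
  have "AE x in lebesgue. (if w x = 0 then \<infinity> else ennreal (?s x)) * indicator ?B x \<noteq> \<infinity>"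
    using T unfolding T_def by (intro nn_integral_PInf_AE borel_measurable_times_ennreal borel_measurable_dual_weight) auto
  then show pos: "AE x in lebesgue. x \<in> ball c r \<longrightarrow> 0 < w x"
  proof (rule AE_mp, intro AE_I2 impI)
    fix x assume "(if w x = 0 then \<infinity> else ennreal (?s x)) * indicator ?B x \<noteq> \<infinity>" "x \<in> ?B"
    then have "w x \<noteq> 0" by (auto simp del: mem_ball)
    then show "0 < w x" using w0[of x] by simp
  qed
  have S_le: "emeasure S ?B \<le> T"
    unfolding T_def S_def by (subst emeasure_density) (auto intro!: nn_integral_mono simp: indicator_def)
  then show Sfin: "emeasure S ?B < top" using T by simp
  \<comment> \<open>The density of \<open>S\<close> is positive wherever \<open>w\<close> is, so an
    \<open>S\<close>-null ball would be Lebesgue-null.\<close>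
  have "emeasure S ?B \<noteq> 0"
  proof
    assume "emeasure S ?B = 0"
    then have "AE x in lebesgue. ennreal (?s x) * indicator ?B x = 0"
      unfolding S_def by (subst (asm) emeasure_density) (auto simp: nn_integral_0_iff_AE)
    with pos have "AE x in lebesgue. x \<notin> ?B"
      by eventually_elim (auto simp: indicator_def)
    then have "emeasure lebesgue ?B = 0"
      by (subst (asm) AE_iff_measurable[of ?B]) auto
    then show False using emeasure_lebesgue_ball_pos(1)[OF r, of c] by simp
  qed
  then show Spos: "0 < emeasure S ?B" by (simp add: zero_less_iff_neq_zero)
  have "emeasure ?W ?B * enn_pow (p - 1) (emeasure S ?B) \<le> emeasure ?W ?B * enn_pow (p - 1) T"
    using p by (intro mult_left_mono enn_pow_mono S_le) auto
  with WT show "emeasure ?W ?B * enn_pow (p - 1) (emeasure S ?B)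
      \<le> enn_pow p (ennreal C) * enn_pow p (emeasure lebesgue ?B)" by (rule order_trans[rotated])
  obtain A where A: "emeasure ?W ?B = ennreal A" "0 < A"
    using W0 weight_ball_finite[OF w, of c r] by (cases "emeasure ?W ?B") auto
  obtain A' where A': "emeasure S ?B = ennreal A'" "0 < A'"
    using Spos Sfin by (cases "emeasure S ?B") auto
  have "emeasure lebesgue ?B \<le> ennreal (A powr (1 / p) * A' powr (1 - 1 / p))"
    using A A' unfolding S_def by (intro emeasure_le_dual_weights[OF wm p _ pos]) auto
  then have "enn_pow p (emeasure lebesgue ?B) \<le> enn_pow p (ennreal (A powr (1 / p) * A' powr (1 - 1 / p)))"
    using p by (intro enn_pow_mono) auto
  also have "\<dots> = ennreal (A * A' powr (p - 1))"
    using p A A' by (simp add: enn_pow_ennreal powr_mult powr_powr left_diff_distrib)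
  also have "\<dots> = emeasure ?W ?B * enn_pow (p - 1) (emeasure S ?B)"
    unfolding A A' using A A' by (simp add: enn_pow_ennreal ennreal_mult)
  finally show "enn_pow p (emeasure lebesgue ?B) \<le> emeasure ?W ?B * enn_pow (p - 1) (emeasure S ?B)" .
qed

lemma ennreal_mult_right_cancel_le:
  "0 < c \<Longrightarrow> c < top \<Longrightarrow> a * c \<le> b * c \<longleftrightarrow> a \<le> (b::ennreal)"
  using ennreal_mult_le_mult_iff[of c a b] by (simp add: mult.commute)

lemma average_times_emeasure:
  "0 < v \<Longrightarrow> v < top \<Longrightarrow> I / v * v = (I::ennreal)"
  by (metis ennreal_divide_times ennreal_divide_self less_irrefl mult.right_neutral)

text \<open>The upper estimate on the fivefold ball against the lower one on \<open>ball c r\<close>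
  bounds the product of both masses. Each factor increases with the ball, so one can be shrunk and
  cancelled, leaving doubling of the other.\<close>

lemma local_A_p_doubling:
  fixes w :: "'a::euclidean_space \<Rightarrow> real" and p :: real
  defines "S \<equiv> wmeasure (\<lambda>x. w x powr (1 - p / (p - 1)))"
  assumes w: "weight w" and p: "1 < p"
    and Ap: "\<And>c r. 0 < r \<Longrightarrow> r < \<kappa> * dist c a \<Longrightarrow> enn_pow (1 / p) (wmeas w (ball c r)) * enn_pow (1 - 1 / p)
        (\<integral>\<^sup>+ x\<in>ball c r. (if w x = 0 then \<infinity> else ennreal (w x powr (1 - p / (p - 1)))) \<partial>lebesgue)
      \<le> ennreal C * emeasure lebesgue (ball c r)"
    and r: "0 < r" "5 * r < \<kappa> * dist c a" and W0: "0 < emeasure (wmeasure w) (ball c r)"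
  defines "D \<equiv> enn_pow p (ennreal C) * enn_pow p (ennreal (5 ^ DIM('a)))"
  shows "emeasure (wmeasure w) (ball c (5 * r)) \<le> D * emeasure (wmeasure w) (ball c r)"
    and "emeasure S (ball c (5 * r)) \<le> enn_pow (1 / (p - 1)) D * emeasure S (ball c r)"
proof -
  let ?W = "wmeasure w" and ?B = "ball c r" and ?B5 = "ball c (5 * r)"
  have wm[measurable]: "w \<in> borel_measurable lebesgue" using w by (auto simp: weight_def)
  have sub: "?B \<subseteq> ?B5" using r by (intro subset_ball) simp
  have mono: "emeasure ?W ?B \<le> emeasure ?W ?B5" "emeasure S ?B \<le> emeasure S ?B5"
    using sub by (auto intro!: emeasure_mono simp: S_def)
  have r5: "0 < 5 * r" "r < \<kappa> * dist c a" using r by auto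
  note B = A_p_ball[OF w p r(1) W0 Ap[OF r(1) r5(2)], folded S_def]
  have W5: "0 < emeasure ?W ?B5" using W0 mono(1) by simp
  note B5 = A_p_ball[OF w p r5(1) W5 Ap[OF r5(1) r(2)], folded S_def]
  have V5: "emeasure lebesgue ?B5 = ennreal (5 ^ DIM('a)) * emeasure lebesgue ?B"
    using emeasure_lebesgue_ball_mult[OF r(1), of 5 c] by simp
  have "enn_pow p (ennreal C) * enn_pow p (emeasure lebesgue ?B5) = D * enn_pow p (emeasure lebesgue ?B)"
    unfolding V5 D_def enn_pow_mult by (simp add: mult.assoc)
  also have "\<dots> \<le> D * (emeasure ?W ?B * enn_pow (p - 1) (emeasure S ?B))"
    by (rule mult_left_mono[OF B(5)]) simp
  finally have le: "emeasure ?W ?B5 * enn_pow (p - 1) (emeasure S ?B5)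
      \<le> D * (emeasure ?W ?B * enn_pow (p - 1) (emeasure S ?B))"
    using B5(4) by (rule order_trans[rotated])
  have "emeasure ?W ?B5 * enn_pow (p - 1) (emeasure S ?B) \<le> emeasure ?W ?B5 * enn_pow (p - 1) (emeasure S ?B5)"
    using p by (intro mult_left_mono enn_pow_mono mono) auto
  also note le
  finally have "emeasure ?W ?B5 * enn_pow (p - 1) (emeasure S ?B) \<le> D * emeasure ?W ?B * enn_pow (p - 1) (emeasure S ?B)"
    by (simp add: mult.assoc)
  moreover have "0 < enn_pow (p - 1) (emeasure S ?B)" "enn_pow (p - 1) (emeasure S ?B) < top"
    using B(2,3) by (simp_all add: zero_less_iff_neq_zero flip: top.not_eq_extremum)
  ultimately show "emeasure ?W ?B5 \<le> D * emeasure ?W ?B"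
    by (simp add: ennreal_mult_right_cancel_le)
  have "enn_pow (p - 1) (emeasure S ?B5) * emeasure ?W ?B \<le> enn_pow (p - 1) (emeasure S ?B5) * emeasure ?W ?B5"
    by (intro mult_left_mono mono) auto
  also have "\<dots> \<le> D * enn_pow (p - 1) (emeasure S ?B) * emeasure ?W ?B"
    using le by (simp add: ac_simps)
  finally have "enn_pow (p - 1) (emeasure S ?B5) \<le> D * enn_pow (p - 1) (emeasure S ?B)"
    using W0 weight_ball_finite[OF w, of c r] by (simp add: ennreal_mult_right_cancel_le)
  then have "enn_pow (1 / (p - 1)) (enn_pow (p - 1) (emeasure S ?B5))
      \<le> enn_pow (1 / (p - 1)) (D * enn_pow (p - 1) (emeasure S ?B))"
    using p by (intro enn_pow_mono) auto
  then show "emeasure S ?B5 \<le> enn_pow (1 / (p - 1)) D * emeasure S ?B"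
    using p by (simp add: enn_pow_mult)
qed

text \<open>Lerner's argument: averages of \<open>f\<close> are dominated by iterating the maximal operators with respect
  to the measures with densities \<open>s = w powr (1 - p')\<close> and \<open>w\<close>, both doubling on the family \<open>F\<close>.\<close>

lemma local_A_p_maximal:
  fixes w :: "'a::euclidean_space \<Rightarrow> real"
  assumes w: "weight w" and p: "1 < p"
    and Ap: "\<And>c r. 0 < r \<Longrightarrow> r < \<kappa> * dist c a \<Longrightarrow> enn_pow (1 / p) (wmeas w (ball c r)) * enn_pow (1 - 1 / p)
        (\<integral>\<^sup>+ x\<in>ball c r. (if w x = 0 then \<infinity> else ennreal (w x powr (1 - p / (p - 1)))) \<partial>lebesgue)
      \<le> ennreal C * emeasure lebesgue (ball c r)"
  obtains K :: ennreal where "K < top" "\<And>F R f.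
    (\<And>c r. (c, r) \<in> F \<Longrightarrow> 0 < r \<and> r \<le> R \<and> 5 * r < \<kappa> * dist c a \<and> 0 < emeasure (wmeasure w) (ball c r)) \<Longrightarrow>
    f \<in> borel_measurable lebesgue \<Longrightarrow>
    (\<integral>\<^sup>+x. enn_pow p (wmax lebesgue F (\<lambda>y. ennreal \<bar>f y\<bar>) x) \<partial>wmeasure w)
      \<le> K * (\<integral>\<^sup>+x. enn_pow p (ennreal \<bar>f x\<bar>) \<partial>wmeasure w)"
proof -
  let ?W = "wmeasure w"
  define s where "s x = w x powr (1 - p / (p - 1))" for x
  define S where "S = wmeasure s"
  have S_eq: "S = wmeasure (\<lambda>x. w x powr (1 - p / (p - 1)))" unfolding S_def s_def ..
  have wm[measurable]: "w \<in> borel_measurable lebesgue" and w0: "\<And>x. 0 \<le> w x"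
    using w by (auto simp: weight_def)
  have [measurable]: "s \<in> borel_measurable lebesgue" unfolding s_def by measurable
  have ball[measurable]: "ball c r \<in> sets lebesgue" for c :: 'a and r by simp
  define p' where "p' = p / (p - 1)"
  have p': "1 < p'" "(p - 1) * p' = p" using p by (auto simp: p'_def field_simps)
  define Cp where "Cp = enn_pow p (ennreal C)"
  \<comment> \<open>\<open>D\<close> is the doubling constant of \<open>w\<close>, its root that of
    \<open>S\<close>; \<open>K1\<close> and \<open>K2\<close> are the corresponding strong-type
    constants. So \<open>K\<close> depends on \<open>p\<close>, \<open>C\<close> and the dimension,
    and on neither \<open>F\<close> nor \<open>R\<close>.\<close>
  define D where "D = enn_pow p (ennreal C) * enn_pow p (ennreal (5 ^ DIM('a)))"
  define K1 where "K1 = ennreal (2 powr p' * p' / (p' - 1)) * D"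
  define K2 where "K2 = ennreal (2 powr p * p / (p - 1)) * enn_pow (1 / (p - 1)) D"
  define K where "K = enn_pow p' Cp * (K1 * K2)"
  show ?thesis
  proof (rule that[of K])
    have "D \<noteq> top" by (simp add: D_def ennreal_mult_eq_top_iff)
    then show "K < top"
      by (simp add: K_def K1_def K2_def Cp_def ennreal_mult_eq_top_iff flip: top.not_eq_extremum)
    fix F :: "('a \<times> real) set" and R and f :: "'a \<Rightarrow> real"
    assume F: "\<And>c r. (c, r) \<in> F \<Longrightarrow> 0 < r \<and> r \<le> R \<and> 5 * r < \<kappa> * dist c a \<and> 0 < emeasure ?W (ball c r)"
      and f[measurable]: "f \<in> borel_measurable lebesgue"
    have F': "0 < r \<and> r \<le> R" if "(c, r) \<in> F" for c r using F that by auto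
    \<comment> \<open>Division by \<open>s\<close> turns Lebesgue integrals of |f| into
      \<open>S\<close>-integrals of \<open>g\<close>; division by \<open>w\<close> in
      \<open>h\<close> plays the same part for \<open>w\<close>. Where \<open>w = 0\<close> the
      quotients take default values, on a set that is null for both measures.\<close>
    define g where "g x = ennreal (\<bar>f x\<bar> / s x)" for x
    have g[measurable]: "g \<in> borel_measurable lebesgue" unfolding g_def by measurable
    define MS where "MS = wmax S F g"
    have MS[measurable]: "MS \<in> borel_measurable lebesgue" unfolding MS_def by measurable
    define h where "h x = enn_pow (p - 1) (MS x) / ennreal (w x)" for x
    have h[measurable]: "h \<in> borel_measurable lebesgue" unfolding h_def by measurable
    define MW where "MW = wmax ?W F h"
    have MW[measurable]: "MW \<in> borel_measurable lebesgue" unfolding MW_def by measurable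

    \<comment> \<open>For every \<open>y\<close> in the ball, the integral of |f| is at most the
      \<open>S\<close>-mass times \<open>MS y\<close>. Taking the power \<open>p - 1\<close> and
      integrating over \<open>y\<close> in the ball produces a \<open>w\<close>-integral of
      \<open>h\<close>, and the upper estimate of \<open>A_p_ball\<close> absorbs the
      masses.\<close>
    have avg: "enn_pow (p - 1) ((\<integral>\<^sup>+ y\<in>ball c r. ennreal \<bar>f y\<bar> \<partial>lebesgue) / emeasure lebesgue (ball c r))
        \<le> Cp * ((\<integral>\<^sup>+ y\<in>ball c r. h y \<partial>?W) / emeasure ?W (ball c r))" if cr: "(c, r) \<in> F" for c r
    proof -
      let ?B = "ball c r"
      have r: "0 < r" "r < \<kappa> * dist c a" "0 < emeasure ?W ?B" using F[OF cr] by auto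
      note B = A_p_ball[OF w p r(1,3) Ap[OF r(1,2)], folded S_eq Cp_def]
      define V where "V = emeasure lebesgue ?B"
      have V: "0 < V" "V < top" unfolding V_def using emeasure_lebesgue_ball_pos[OF r(1)] by auto
      have V': "0 < enn_pow (p - 1) V" "enn_pow (p - 1) V < top"
        using V by (simp_all add: zero_less_iff_neq_zero flip: top.not_eq_extremum)
      define I where "I = (\<integral>\<^sup>+ y\<in>?B. ennreal \<bar>f y\<bar> \<partial>lebesgue)"
      define H where "H = (\<integral>\<^sup>+ y\<in>?B. h y \<partial>?W)"
      have I: "I = (\<integral>\<^sup>+ y\<in>?B. g y \<partial>S)"
      proof -
        have "(\<integral>\<^sup>+ y\<in>?B. g y \<partial>S) = (\<integral>\<^sup>+ y. ennreal (s y) * (g y * indicator ?B y) \<partial>lebesgue)"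
          unfolding S_def by (subst nn_integral_density) auto
        also have "\<dots> = I"
          unfolding I_def
        proof (rule nn_integral_cong_AE, rule AE_mp[OF B(1)], rule AE_I2, rule impI)
          fix x assume "x \<in> ?B \<longrightarrow> 0 < w x"
          then show "ennreal (s x) * (g x * indicator ?B x) = ennreal \<bar>f x\<bar> * indicator ?B x"
            by (auto simp: indicator_def g_def s_def simp flip: ennreal_mult)
        qed
        finally show ?thesis ..
      qed
      have H: "H = (\<integral>\<^sup>+ y\<in>?B. enn_pow (p - 1) (MS y) \<partial>lebesgue)"
      proof -
        have "H = (\<integral>\<^sup>+ y. ennreal (w y) * (h y * indicator ?B y) \<partial>lebesgue)"
          unfolding H_def by (subst nn_integral_density) auto
        also have "\<dots> = (\<integral>\<^sup>+ y\<in>?B. enn_pow (p - 1) (MS y) \<partial>lebesgue)"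
        proof (rule nn_integral_cong_AE, rule AE_mp[OF B(1)], rule AE_I2, rule impI)
          fix x assume "x \<in> ?B \<longrightarrow> 0 < w x"
          then show "ennreal (w x) * (h x * indicator ?B x) = enn_pow (p - 1) (MS x) * indicator ?B x"
            using average_times_emeasure[of "ennreal (w x)" "enn_pow (p - 1) (MS x)"]
            by (auto simp: indicator_def h_def mult.commute)
        qed
        finally show ?thesis .
      qed
      have "enn_pow (p - 1) I * V = (\<integral>\<^sup>+ y\<in>?B. enn_pow (p - 1) I \<partial>lebesgue)"
        unfolding V_def by (subst nn_integral_cmult_indicator) auto
      also have "\<dots> \<le> (\<integral>\<^sup>+ y. enn_pow (p - 1) (emeasure S ?B) * (enn_pow (p - 1) (MS y) * indicator ?B y) \<partial>lebesgue)"
      proof (rule nn_integral_mono)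
        fix y
        have "I \<le> emeasure S ?B * MS y" if "y \<in> ?B"
        proof -
          have "I / emeasure S ?B \<le> MS y" unfolding I MS_def by (rule average_le_wmax[OF cr that])
          then show ?thesis using B(2,3) by (simp add: divide_le_ennreal_iff mult.commute)
        qed
        then show "enn_pow (p - 1) I * indicator ?B y
            \<le> enn_pow (p - 1) (emeasure S ?B) * (enn_pow (p - 1) (MS y) * indicator ?B y)"
          using p by (auto simp: indicator_def enn_pow_mono simp flip: enn_pow_mult)
      qed
      also have "\<dots> = enn_pow (p - 1) (emeasure S ?B) * H"
        unfolding H by (rule nn_integral_cmult) measurable
      finally have "emeasure ?W ?B * (enn_pow (p - 1) I * V) \<le> emeasure ?W ?B * (enn_pow (p - 1) (emeasure S ?B) * H)"
        by (rule mult_left_mono) simp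
      also have "\<dots> \<le> Cp * enn_pow p V * H"
        unfolding mult.assoc[symmetric] V_def by (rule mult_right_mono[OF B(4)]) simp
      also have "enn_pow p V = enn_pow (p - 1) V * V"
        using p enn_pow_add[of "p - 1" 1 V] by simp
      finally have "emeasure ?W ?B * enn_pow (p - 1) I * V \<le> Cp * H * enn_pow (p - 1) V * V"
        by (simp add: ac_simps)
      then have "emeasure ?W ?B * enn_pow (p - 1) I \<le> Cp * H * enn_pow (p - 1) V"
        using V by (simp add: ennreal_mult_right_cancel_le)
      also have "I = I / V * V" using V by (simp add: average_times_emeasure)
      finally have "emeasure ?W ?B * enn_pow (p - 1) (I / V) * enn_pow (p - 1) V \<le> Cp * H * enn_pow (p - 1) V"
        by (simp add: enn_pow_mult mult.assoc)
      then have "enn_pow (p - 1) (I / V) * emeasure ?W ?B \<le> Cp * H"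
        unfolding ennreal_mult_right_cancel_le[OF V'] by (simp add: mult.commute)
      then have "enn_pow (p - 1) (I / V) \<le> Cp * H / emeasure ?W ?B"
        using r(3) weight_ball_finite[OF w, of c r] by (simp add: ennreal_le_divide_iff)
      then show ?thesis unfolding I_def V_def H_def by (simp add: ennreal_times_divide)
    qed
    have pt: "enn_pow p (wmax lebesgue F (\<lambda>y. ennreal \<bar>f y\<bar>) x) \<le> enn_pow p' Cp * enn_pow p' (MW x)" for x
    proof -
      have "wmax lebesgue F (\<lambda>y. ennreal \<bar>f y\<bar>) x \<le> enn_pow (1 / (p - 1)) (Cp * MW x)"
        unfolding wmax_le_iff
      proof (intro allI impI)
        fix c r assume cr: "(c, r) \<in> F \<and> x \<in> ball c r"
        let ?J = "(\<integral>\<^sup>+ y\<in>ball c r. ennreal \<bar>f y\<bar> \<partial>lebesgue) / emeasure lebesgue (ball c r)"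
        have "enn_pow (p - 1) ?J \<le> Cp * ((\<integral>\<^sup>+ y\<in>ball c r. h y \<partial>?W) / emeasure ?W (ball c r))"
          using avg cr by blast
        also have "\<dots> \<le> Cp * MW x"
          unfolding MW_def using cr by (intro mult_left_mono average_le_wmax) auto
        finally have "enn_pow (1 / (p - 1)) (enn_pow (p - 1) ?J) \<le> enn_pow (1 / (p - 1)) (Cp * MW x)"
          using p by (intro enn_pow_mono) auto
        then show "?J \<le> enn_pow (1 / (p - 1)) (Cp * MW x)" using p by simp
      qed
      then have "enn_pow p (wmax lebesgue F (\<lambda>y. ennreal \<bar>f y\<bar>) x) \<le> enn_pow p (enn_pow (1 / (p - 1)) (Cp * MW x))"
        using p by (intro enn_pow_mono) auto
      also have "\<dots> = enn_pow p' Cp * enn_pow p' (MW x)"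
        by (simp add: enn_pow_enn_pow enn_pow_mult p'_def)
      finally show ?thesis .
    qed
    have "(\<integral>\<^sup>+x. enn_pow p (wmax lebesgue F (\<lambda>y. ennreal \<bar>f y\<bar>) x) \<partial>?W)
        \<le> (\<integral>\<^sup>+x. enn_pow p' Cp * enn_pow p' (MW x) \<partial>?W)"
      by (intro nn_integral_mono pt)
    also have "\<dots> = enn_pow p' Cp * (\<integral>\<^sup>+x. enn_pow p' (MW x) \<partial>?W)"
      by (intro nn_integral_cmult) measurable
    also have "\<dots> \<le> enn_pow p' Cp * (K1 * (\<integral>\<^sup>+x. enn_pow p' (h x) \<partial>?W))"
    proof (rule mult_left_mono)
      show "(\<integral>\<^sup>+x. enn_pow p' (MW x) \<partial>?W) \<le> K1 * (\<integral>\<^sup>+x. enn_pow p' (h x) \<partial>?W)"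
        unfolding MW_def K1_def
      proof (rule wmax_strong_type[OF _ _ h F' _ p'(1)])
        fix c r assume "(c, r) \<in> F"
        then show "emeasure ?W (ball c (5 * r)) \<le> D * emeasure ?W (ball c r)"
          unfolding D_def using F by (intro local_A_p_doubling(1)[OF w p Ap]) auto
      qed (auto intro: sigma_finite_density_lebesgue)
    qed simp
    also have "(\<integral>\<^sup>+x. enn_pow p' (h x) \<partial>?W) = (\<integral>\<^sup>+x. ennreal (w x) * enn_pow p' (h x) \<partial>lebesgue)"
      by (subst nn_integral_density) auto
    also have "\<dots> = (\<integral>\<^sup>+x. ennreal (s x) * enn_pow p (MS x) \<partial>lebesgue)"
    proof (rule nn_integral_cong)
      fix x
      \<comment> \<open>The exponents close up: \<open>(p - 1) * p' = p\<close>, and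
        \<open>w\<close> times the power \<open>p'\<close> of its reciprocal is the dual weight
        \<open>s\<close>.\<close>
      show "ennreal (w x) * enn_pow p' (h x) = ennreal (s x) * enn_pow p (MS x)"
      proof (cases "w x = 0")
        case False
        then have wx: "0 < w x" using w0[of x] by simp
        have "h x = enn_pow (p - 1) (MS x) * ennreal (1 / w x)"
          unfolding h_def using wx by (simp add: divide_ennreal_def inverse_ennreal inverse_eq_divide)
        then have "enn_pow p' (h x) = enn_pow p (MS x) * ennreal ((1 / w x) powr p')"
          using wx p' by (simp add: enn_pow_mult enn_pow_enn_pow enn_pow_ennreal mult.commute)
        moreover have "ennreal (w x) * ennreal ((1 / w x) powr p') = ennreal (s x)"
          using wx by (simp add: s_def p'_def powr_divide powr_diff flip: ennreal_mult)
        ultimately show ?thesis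
          by (metis mult.assoc mult.commute)
      qed (simp add: s_def)
    qed
    also have "\<dots> = (\<integral>\<^sup>+x. enn_pow p (MS x) \<partial>S)"
      unfolding S_def by (subst nn_integral_density) auto
    also have "enn_pow p' Cp * (K1 * \<dots>) \<le> enn_pow p' Cp * (K1 * (K2 * (\<integral>\<^sup>+x. enn_pow p (g x) \<partial>S)))"
    proof (intro mult_left_mono)
      show "(\<integral>\<^sup>+x. enn_pow p (MS x) \<partial>S) \<le> K2 * (\<integral>\<^sup>+x. enn_pow p (g x) \<partial>S)"
        unfolding MS_def K2_def
      proof (rule wmax_strong_type[OF _ _ g F' _ p])
        fix c r assume "(c, r) \<in> F"
        then show "emeasure S (ball c (5 * r)) \<le> enn_pow (1 / (p - 1)) D * emeasure S (ball c r)"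
          unfolding D_def S_eq using F by (intro local_A_p_doubling(2)[OF w p Ap]) auto
      qed (auto simp: S_def intro: sigma_finite_density_lebesgue)
    qed auto
    also have "(\<integral>\<^sup>+x. enn_pow p (g x) \<partial>S) = (\<integral>\<^sup>+x. ennreal (s x) * enn_pow p (g x) \<partial>lebesgue)"
      unfolding S_def by (subst nn_integral_density) auto
    also have "enn_pow p' Cp * (K1 * (K2 * \<dots>)) \<le> enn_pow p' Cp * (K1 * (K2 * (\<integral>\<^sup>+x. ennreal (w x) * enn_pow p (ennreal \<bar>f x\<bar>) \<partial>lebesgue)))"
    proof (intro mult_left_mono nn_integral_mono)
      fix x
      \<comment> \<open>Dually, \<open>s x powr (1 - p)\<close> gives back
        \<open>w x\<close>.\<close>
      show "ennreal (s x) * enn_pow p (g x) \<le> ennreal (w x) * enn_pow p (ennreal \<bar>f x\<bar>)"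
      proof (cases "w x = 0")
        case False
        then have wx: "0 < w x" using w0[of x] by simp
        then have sx: "0 < s x" by (simp add: s_def)
        have "s x * (\<bar>f x\<bar> / s x) powr p = \<bar>f x\<bar> powr p * (s x powr (1 - p))"
          using sx by (simp add: powr_divide powr_diff)
        also have "s x powr (1 - p) = w x powr ((1 - p / (p - 1)) * (1 - p))"
          using wx by (simp add: s_def powr_powr)
        also have "(1 - p / (p - 1)) * (1 - p) = 1" using p by (simp add: field_simps)
        finally have "s x * (\<bar>f x\<bar> / s x) powr p = w x * \<bar>f x\<bar> powr p" using wx by simp
        then show ?thesis using sx wx by (simp add: g_def enn_pow_ennreal flip: ennreal_mult)
      qed (simp add: s_def)
    qed auto
    also have "(\<integral>\<^sup>+x. ennreal (w x) * enn_pow p (ennreal \<bar>f x\<bar>) \<partial>lebesgue) = (\<integral>\<^sup>+x. enn_pow p (ennreal \<bar>f x\<bar>) \<partial>?W)"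
      by (subst nn_integral_density) auto
    finally show "(\<integral>\<^sup>+x. enn_pow p (wmax lebesgue F (\<lambda>y. ennreal \<bar>f y\<bar>) x) \<partial>?W)
      \<le> K * (\<integral>\<^sup>+x. enn_pow p (ennreal \<bar>f x\<bar>) \<partial>?W)"
      by (simp add: K_def mult.assoc)
  qed
qed

text \<open>Inserting the condition under the integral bounds the Lebesgue average of |f| on a local
  ball by a constant times its \<open>w\<close>-average. The weak bound for the
  \<open>w\<close>-maximal operator then transfers after rescaling the level.\<close>

lemma local_A_1_maximal:
  fixes w :: "'a::euclidean_space \<Rightarrow> real"
  assumes w: "weight w"
    and A1: "\<And>c r. 0 < r \<Longrightarrow> r < \<kappa> * dist c a \<Longrightarrow> AE x in lebesgue. x \<in> ball c r \<longrightarrow>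
         wmeas w (ball c r) \<le> ennreal C * emeasure lebesgue (ball c r) * ennreal (w x)"
  obtains K :: ennreal where "K < top" "\<And>F R f t.
    (\<And>c r. (c, r) \<in> F \<Longrightarrow> 0 < r \<and> r \<le> R \<and> 5 * r < \<kappa> * dist c a \<and> 0 < emeasure (wmeasure w) (ball c r)) \<Longrightarrow>
    f \<in> borel_measurable lebesgue \<Longrightarrow>
    t * emeasure (wmeasure w) {x. t < wmax lebesgue F (\<lambda>y. ennreal \<bar>f y\<bar>) x}
      \<le> K * (\<integral>\<^sup>+x. ennreal \<bar>f x\<bar> \<partial>wmeasure w)"
proof -
  let ?W = "wmeasure w"
  have wm[measurable]: "w \<in> borel_measurable lebesgue" using w by (auto simp: weight_def)
  have ball[measurable]: "ball c r \<in> sets lebesgue" for c :: 'a and r by simp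
  \<comment> \<open>Kept at least \<open>1\<close> so that levels can be divided by it.\<close>
  define C' where "C' = ennreal (max C 1)"
  have C': "0 < C'" "C' < top" "ennreal C \<le> C'"
    by (auto simp: C'_def ennreal_leI)
  have A1': "AE x in lebesgue. x \<in> ball c r \<longrightarrow>
      emeasure ?W (ball c r) \<le> C' * emeasure lebesgue (ball c r) * ennreal (w x)"
    if "0 < r" "r < \<kappa> * dist c a" for c r
  proof -
    have "ennreal C * emeasure lebesgue (ball c r) * ennreal (w x) \<le> C' * emeasure lebesgue (ball c r) * ennreal (w x)" for x
      using C'(3) by (intro mult_right_mono) auto
    then show ?thesis
      using A1[OF that] wmeas_eq_emeasure[OF wm ball, of c r]
      by (auto elim!: eventually_mono intro: order_trans simp del: mem_ball)
  qed
  define D where "D = C' * ennreal (5 ^ DIM('a))"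
  have doubling: "emeasure ?W (ball c (5 * r)) \<le> D * emeasure ?W (ball c r)"
    if r: "0 < r" "5 * r < \<kappa> * dist c a" for c r
  proof -
    let ?B = "ball c r" and ?B5 = "ball c (5 * r)"
    have V5: "emeasure lebesgue ?B5 = ennreal (5 ^ DIM('a)) * emeasure lebesgue ?B"
      using emeasure_lebesgue_ball_mult[OF r(1), of 5 c] by simp
    have r5: "0 < 5 * r" using r by simp
    have sub: "?B \<subseteq> ?B5" using r by (intro subset_ball) simp
    \<comment> \<open>Doubling: the condition on the fivefold ball is integrated over the smaller
      ball.\<close>
    have "emeasure ?W ?B5 * emeasure lebesgue ?B = (\<integral>\<^sup>+x\<in>?B. emeasure ?W ?B5 \<partial>lebesgue)"
      by (subst nn_integral_cmult_indicator) auto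
    also have "\<dots> \<le> (\<integral>\<^sup>+x. (C' * emeasure lebesgue ?B5) * (ennreal (w x) * indicator ?B x) \<partial>lebesgue)"
    proof (rule nn_integral_mono_AE, rule AE_mp[OF A1'[OF r5 r(2)]], rule AE_I2, rule impI)
      fix x assume "x \<in> ?B5 \<longrightarrow> emeasure ?W ?B5 \<le> C' * emeasure lebesgue ?B5 * ennreal (w x)"
      then show "emeasure ?W ?B5 * indicator ?B x \<le> C' * emeasure lebesgue ?B5 * (ennreal (w x) * indicator ?B x)"
        using sub by (cases "x \<in> ?B") (auto simp del: mem_ball emeasure_completion)
    qed
    also have "\<dots> = (C' * emeasure lebesgue ?B5) * emeasure ?W ?B"
      by (subst nn_integral_cmult) (auto simp: emeasure_density)
    also have "\<dots> = D * emeasure ?W ?B * emeasure lebesgue ?B"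
      unfolding V5 D_def by (simp add: ac_simps)
    finally show ?thesis
      using ennreal_mult_right_cancel_le[OF emeasure_lebesgue_ball_pos[OF r(1), of c]] by simp
  qed
  show ?thesis
  proof (rule that[of "C' * D"])
    show "C' * D < top" using C' by (simp add: D_def ennreal_mult_less_top)
    fix F :: "('a \<times> real) set" and R and f :: "'a \<Rightarrow> real" and t :: ennreal
    assume F: "\<And>c r. (c, r) \<in> F \<Longrightarrow> 0 < r \<and> r \<le> R \<and> 5 * r < \<kappa> * dist c a \<and> 0 < emeasure ?W (ball c r)"
      and f[measurable]: "f \<in> borel_measurable lebesgue"
    let ?M = "wmax lebesgue F (\<lambda>y. ennreal \<bar>f y\<bar>)" and ?MW = "wmax ?W F (\<lambda>y. ennreal \<bar>f y\<bar>)"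
    have le: "?M x \<le> C' * ?MW x" for x
      unfolding wmax_le_iff
    proof (intro allI impI)
      fix c r assume cr: "(c, r) \<in> F \<and> x \<in> ball c r"
      let ?B = "ball c r"
      have r: "0 < r" "r < \<kappa> * dist c a" "0 < emeasure ?W ?B" using F cr by fastforce+
      define V where "V = emeasure lebesgue ?B"
      have V: "0 < V" "V < top" unfolding V_def using emeasure_lebesgue_ball_pos[OF r(1)] by auto
      define I where "I = (\<integral>\<^sup>+ y\<in>?B. ennreal \<bar>f y\<bar> \<partial>lebesgue)"
      define H where "H = (\<integral>\<^sup>+ y\<in>?B. ennreal \<bar>f y\<bar> \<partial>?W)"
      have "I / V * emeasure ?W ?B * V = I * emeasure ?W ?B"
        using average_times_emeasure[OF V, of I] by (metis mult.assoc mult.commute)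
      also have "\<dots> = (\<integral>\<^sup>+ y. emeasure ?W ?B * (ennreal \<bar>f y\<bar> * indicator ?B y) \<partial>lebesgue)"
        unfolding I_def by (subst nn_integral_cmult) (auto simp: mult.commute)
      also have "\<dots> \<le> (\<integral>\<^sup>+ y. (C' * V) * (ennreal (w y) * (ennreal \<bar>f y\<bar> * indicator ?B y)) \<partial>lebesgue)"
      proof (rule nn_integral_mono_AE, rule AE_mp[OF A1'[OF r(1,2)]], rule AE_I2, rule impI)
        fix y assume "y \<in> ?B \<longrightarrow> emeasure ?W ?B \<le> C' * emeasure lebesgue ?B * ennreal (w y)"
        then have "emeasure ?W ?B * ennreal \<bar>f y\<bar> \<le> C' * V * ennreal (w y) * ennreal \<bar>f y\<bar>" if "y \<in> ?B"
          using that unfolding V_def by (intro mult_right_mono) auto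
        then show "emeasure ?W ?B * (ennreal \<bar>f y\<bar> * indicator ?B y) \<le> C' * V * (ennreal (w y) * (ennreal \<bar>f y\<bar> * indicator ?B y))"
          by (cases "y \<in> ?B") (auto simp: mult.assoc simp del: mem_ball)
      qed
      also have "\<dots> = C' * V * H"
        unfolding H_def by (subst nn_integral_cmult) (auto simp: nn_integral_density)
      also have "\<dots> = C' * H * V" by (simp add: ac_simps)
      finally have "I / V * emeasure ?W ?B \<le> C' * H"
        unfolding ennreal_mult_right_cancel_le[OF V] .
      then have "I / V \<le> C' * (H / emeasure ?W ?B)"
        using r(3) weight_ball_finite[OF w, of c r] by (simp add: ennreal_le_divide_iff ennreal_times_divide)
      also have "\<dots> \<le> C' * ?MW x"
        unfolding H_def using cr by (intro mult_left_mono average_le_wmax) auto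
      finally show "(\<integral>\<^sup>+ y\<in>?B. ennreal \<bar>f y\<bar> \<partial>lebesgue) / emeasure lebesgue ?B \<le> C' * ?MW x"
        unfolding I_def V_def .
    qed
    have "emeasure ?W {x. t < ?M x} \<le> emeasure ?W {x. t / C' < ?MW x}"
    proof (rule emeasure_mono)
      show "{x. t < ?M x} \<subseteq> {x. t / C' < ?MW x}"
      proof safe
        fix x assume "t < ?M x"
        then have "t < ?MW x * C'" using le[of x] by (simp add: mult.commute)
        then show "t / C' < ?MW x" using C' by (simp add: divide_less_ennreal)
      qed
    qed (simp add: wmax_superlevel_lebesgue)
    then have "t * emeasure ?W {x. t < ?M x} \<le> (C' * (t / C')) * emeasure ?W {x. t / C' < ?MW x}"
      using average_times_emeasure[OF C'(1,2), of t] by (intro mult_mono) (auto simp: mult.commute)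
    also have "\<dots> \<le> C' * (D * (\<integral>\<^sup>+x. ennreal \<bar>f x\<bar> \<partial>?W))"
      unfolding mult.assoc
    proof (intro mult_left_mono wmax_weak_type[where R = R])
      fix c r assume "(c, r) \<in> F"
      then show "0 < r \<and> r \<le> R" "emeasure ?W (ball c (5 * r)) \<le> D * emeasure ?W (ball c r)"
        using F by (auto intro!: doubling)
    qed auto
    finally show "t * emeasure ?W {x. t < ?M x} \<le> C' * D * (\<integral>\<^sup>+x. ennreal \<bar>f x\<bar> \<partial>?W)"
      by (simp add: mult.assoc)
  qed
qed

text \<open>By Lindelof, countably many null balls already cover the union of all null balls. Hence
  restricting a maximal operator to balls of positive mass changes nothing at almost every
  point.\<close>

lemma AE_all_balls_positive:
  fixes \<mu> :: "'a::euclidean_space measure"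
  assumes sets: "sets \<mu> = sets lebesgue"
  shows "AE x in \<mu>. \<forall>c r. x \<in> ball c r \<longrightarrow> 0 < emeasure \<mu> (ball c r)"
proof -
  define \<F> where "\<F> = {B. \<exists>c r. B = ball c r \<and> emeasure \<mu> B = 0}"
  obtain \<F>' where \<F>': "\<F>' \<subseteq> \<F>" "countable \<F>'" "\<Union>\<F>' = \<Union>\<F>"
    by (rule Lindelof[of \<F>]) (auto simp: \<F>_def)
  have "\<Union>\<F>' \<in> null_sets \<mu>"
    using \<F>' by (intro null_sets_UN'[of \<F>' "\<lambda>x. x", simplified]) (auto simp: \<F>_def null_sets_def sets)
  then have "\<Union>\<F> \<in> null_sets \<mu>" using \<F>' by simp
  then show ?thesis
    by (rule AE_I') (auto simp: \<F>_def simp del: mem_ball)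
qed

section \<open>Morrey norms of indicators and averages under \<open>A_morrey\<close>\<close>

lemma nn_integral_indicator_morrey:
  fixes w :: "'a::euclidean_space \<Rightarrow> real"
  assumes "0 < p" "\<And>c r. 0 < r \<Longrightarrow> 0 < \<phi> (ball c r)" "0 < r" and [measurable]: "w \<in> borel_measurable lebesgue"
  shows "emeasure (wmeasure w) (ball c r)
    \<le> ennreal (\<phi> (ball c r)) * enn_pow p (morrey_norm p \<phi> w (\<lambda>x. ennreal (indicator (ball c r) x)))"
proof -
  have "emeasure (wmeasure w) (ball c r)
      = (\<integral>\<^sup>+x\<in>ball c r. enn_pow p (ennreal (indicator (ball c r) x)) * ennreal (w x) \<partial>lebesgue)"
    by (subst emeasure_density) (auto intro!: nn_integral_cong simp: indicator_def)
  also have "\<dots> \<le> ennreal (\<phi> (ball c r)) * enn_pow p (morrey_norm p \<phi> w (\<lambda>x. ennreal (indicator (ball c r) x)))"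
    by (rule nn_integral_morrey_le) (use assms in auto)
  finally show ?thesis .
qed

lemma morrey_norm_mono:
  assumes "0 \<le> p" "\<And>x. f x \<le> g x"
  shows "morrey_norm p \<phi> w f \<le> morrey_norm p \<phi> w g"
  unfolding morrey_norm_def using assms
  by (intro SUP_mono') (auto intro!: enn_pow_mono mult_left_mono nn_integral_mono mult_right_mono)

text \<open>Homogeneity of the Koethe norm, which only sees functions of norm at most
  \<open>1\<close>. The norm of \<open>f\<close> may be \<open>0\<close>, so \<open>f\<close> is
  divided by a positive upper bound \<open>l\<close> of its norm, which is then lowered to the
  norm.\<close>

lemma A_morrey_average:
  fixes w :: "'a::euclidean_space \<Rightarrow> real"
  assumes p: "0 < p" and phi: "\<And>c r. 0 < r \<Longrightarrow> 0 < \<phi> (ball c r)"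
    and A: "\<And>c r. 0 < r \<Longrightarrow> morrey_norm p \<phi> w (\<lambda>x. ennreal (indicator (ball c r) x))
      * kothe_norm (morrey_norm p \<phi> w) (indicator (ball c r)) \<le> ennreal C * emeasure lebesgue (ball c r)"
    and f[measurable]: "f \<in> borel_measurable lebesgue" and w[measurable]: "w \<in> borel_measurable lebesgue"
    and fin: "morrey_norm p \<phi> w (\<lambda>x. ennreal \<bar>f x\<bar>) < \<infinity>" and r: "0 < r"
  shows "morrey_norm p \<phi> w (\<lambda>x. ennreal (indicator (ball c r) x)) * (\<integral>\<^sup>+ y\<in>ball c r. ennreal \<bar>f y\<bar> \<partial>lebesgue)
    \<le> (ennreal C * morrey_norm p \<phi> w (\<lambda>x. ennreal \<bar>f x\<bar>)) * emeasure lebesgue (ball c r)"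
proof -
  let ?B = "ball c r" and ?N = "morrey_norm p \<phi> w (\<lambda>x. ennreal \<bar>f x\<bar>)"
  let ?X = "morrey_norm p \<phi> w (\<lambda>x. ennreal (indicator ?B x))"
  have [measurable]: "?B \<in> sets lebesgue" by simp
  define Q where "Q = ?X * (\<integral>\<^sup>+ y\<in>?B. ennreal \<bar>f y\<bar> \<partial>lebesgue)"
  define E where "E = ennreal C * emeasure lebesgue ?B"
  have E: "E < top" unfolding E_def using emeasure_lebesgue_ball_pos[OF r, of c]
    by (simp add: ennreal_mult_less_top)
  have scaled: "Q \<le> ennreal l * E" if l: "0 < l" "?N \<le> ennreal l" for l
  proof -
    let ?f = "\<lambda>x. f x / l"
    have "morrey_norm p \<phi> w (\<lambda>x. ennreal \<bar>?f x\<bar>) \<le> 1"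
    proof (rule iffD2[OF morrey_norm_le_iff[where \<phi> = \<phi>, OF p]], erule phi, intro allI impI)
      fix c' :: 'a and r' :: real assume r': "0 < r'"
      have [measurable]: "ball c' r' \<in> sets lebesgue" by simp
      have "(\<integral>\<^sup>+x\<in>ball c' r'. enn_pow p (ennreal \<bar>?f x\<bar>) * ennreal (w x) \<partial>lebesgue)
          = (\<integral>\<^sup>+x. enn_pow p (ennreal (1 / l)) * (enn_pow p (ennreal \<bar>f x\<bar>) * ennreal (w x) * indicator (ball c' r') x) \<partial>lebesgue)"
      proof (rule nn_integral_cong)
        fix x
        have "ennreal \<bar>?f x\<bar> = ennreal (1 / l) * ennreal \<bar>f x\<bar>" using l by (simp flip: ennreal_mult)
        then show "enn_pow p (ennreal \<bar>?f x\<bar>) * ennreal (w x) * indicator (ball c' r') x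
          = enn_pow p (ennreal (1 / l)) * (enn_pow p (ennreal \<bar>f x\<bar>) * ennreal (w x) * indicator (ball c' r') x)"
          by (simp add: enn_pow_mult mult.assoc)
      qed
      also have "\<dots> = enn_pow p (ennreal (1 / l)) * (\<integral>\<^sup>+x\<in>ball c' r'. enn_pow p (ennreal \<bar>f x\<bar>) * ennreal (w x) \<partial>lebesgue)"
        by (rule nn_integral_cmult) measurable
      also have "\<dots> \<le> enn_pow p (ennreal (1 / l)) * (ennreal (\<phi> (ball c' r')) * enn_pow p ?N)"
        by (intro mult_left_mono nn_integral_morrey_le p phi r') auto
      also have "\<dots> \<le> enn_pow p (ennreal (1 / l)) * (ennreal (\<phi> (ball c' r')) * enn_pow p (ennreal l))"
        using p l by (intro mult_left_mono enn_pow_mono) auto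
      also have "\<dots> = ennreal (\<phi> (ball c' r')) * enn_pow p (ennreal (1 / l) * ennreal l)"
        by (simp add: enn_pow_mult ac_simps)
      also have "ennreal (1 / l) * ennreal l = 1" using l by (simp flip: ennreal_mult)
      finally show "(\<integral>\<^sup>+x\<in>ball c' r'. enn_pow p (ennreal \<bar>?f x\<bar>) * ennreal (w x) \<partial>lebesgue)
          \<le> ennreal (\<phi> (ball c' r')) * enn_pow p 1" .
    qed
    then have "(\<integral>\<^sup>+ x. ennreal \<bar>?f x * indicator ?B x\<bar> \<partial>lebesgue) \<le> kothe_norm (morrey_norm p \<phi> w) (indicator ?B)"
      unfolding kothe_norm_def by (intro SUP_upper2[of ?f]) auto
    then have "ennreal l * (\<integral>\<^sup>+ x. ennreal \<bar>?f x * indicator ?B x\<bar> \<partial>lebesgue) \<le> ennreal l * kothe_norm (morrey_norm p \<phi> w) (indicator ?B)"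
      by (rule mult_left_mono) simp
    also have "ennreal l * (\<integral>\<^sup>+ x. ennreal \<bar>?f x * indicator ?B x\<bar> \<partial>lebesgue)
       = (\<integral>\<^sup>+ x. ennreal l * ennreal \<bar>?f x * indicator ?B x\<bar> \<partial>lebesgue)"
      by (rule nn_integral_cmult[symmetric]) measurable
    also have "\<dots> = (\<integral>\<^sup>+ y\<in>?B. ennreal \<bar>f y\<bar> \<partial>lebesgue)"
      using l by (intro nn_integral_cong) (auto simp: indicator_def simp flip: ennreal_mult)
    finally have "Q \<le> ?X * (ennreal l * kothe_norm (morrey_norm p \<phi> w) (indicator ?B))"
      unfolding Q_def by (rule mult_left_mono) simp
    also have "\<dots> \<le> ennreal l * E"
      using mult_left_mono[OF A[OF r, of c], of "ennreal l"] unfolding E_def by (simp add: ac_simps)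
    finally show ?thesis .
  qed
  obtain N where N: "?N = ennreal N" "0 \<le> N" using fin by (cases ?N) auto
  obtain e where e: "E = ennreal e" "0 \<le> e" using E by (cases E) auto
  have "Q \<le> ?N * E"
  proof (rule ennreal_le_epsilon)
    fix d :: real assume d: "0 < d"
    \<comment> \<open>The summand \<open>d / (e + 1)\<close> keeps the divisor positive and costs at
      most \<open>d\<close> after multiplication by \<open>e\<close>.\<close>
    have "Q \<le> ennreal (N + d / (e + 1)) * E"
      using N e d by (intro scaled) (auto intro!: ennreal_leI add_nonneg_pos)
    also have "\<dots> = ennreal (N * e + d * (e / (e + 1)))"
      unfolding e using N e d by (simp add: distrib_right flip: ennreal_mult)
    also have "\<dots> \<le> ennreal (N * e + d)"
      using e d by (intro ennreal_leI add_left_mono mult_left_le) auto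
    also have "\<dots> = ?N * E + ennreal d" unfolding N e using N e d by (simp add: ennreal_mult)
    finally show "Q \<le> ?N * E + ennreal d" .
  qed
  then show ?thesis unfolding Q_def E_def by (simp add: ac_simps)
qed

section \<open>Boundedness on Morrey spaces\<close>

text \<open>Averages over balls of radius at least \<open>r\<close> are controlled by \<open>A_morrey\<close>, because three times such a
  ball contains \<open>ball c r\<close>; smaller balls only see \<open>f\<close> near \<open>ball c r\<close> and belong to the local family.\<close>

lemma hl_max_le_local:
  fixes w f :: "'a::euclidean_space \<Rightarrow> real" and \<phi> :: "'a set \<Rightarrow> real" and a c x :: 'a
    and p \<kappa> r :: real and E :: ennreal
  defines "X \<equiv> \<lambda>c r. morrey_norm p \<phi> w (\<lambda>x. ennreal (indicator (ball c r) x))"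
  assumes p: "0 < p" and \<kappa>: "0 < \<kappa>" "\<kappa> < 1"
    and avg: "\<And>c r. 0 < r \<Longrightarrow> X c r * (\<integral>\<^sup>+ y\<in>ball c r. ennreal \<bar>f y\<bar> \<partial>lebesgue) \<le> E * emeasure lebesgue (ball c r)"
    and r: "0 < r" "r < \<kappa> / 10 * dist c a" and X: "0 < X c r" "X c r < top"
    and x: "x \<in> ball c r" and pos: "\<And>c r. x \<in> ball c r \<Longrightarrow> 0 < emeasure (wmeasure w) (ball c r)"
  defines "F \<equiv> {(c', r'). 0 < r' \<and> r' \<le> r \<and> 5 * r' < \<kappa> * dist c' a \<and> 0 < emeasure (wmeasure w) (ball c' r')}"
  shows "hl_max f x \<le> max (ennreal (3 ^ DIM('a)) * E / X c r)
    (wmax lebesgue F (\<lambda>y. ennreal \<bar>f y * indicator (ball c (4 * r)) y\<bar>) x)"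
  unfolding hl_max_eq_wmax wmax_le_iff
proof (intro allI impI, elim conjE)
  fix c' r' assume "(c', r') \<in> {(c, r). 0 < r}" and x': "x \<in> ball c' r'"
  then have r': "0 < r'" by simp
  let ?J = "(\<integral>\<^sup>+ y\<in>ball c' r'. ennreal \<bar>f y\<bar> \<partial>lebesgue) / emeasure lebesgue (ball c' r')"
  note V = emeasure_lebesgue_ball_pos[OF r', of c']
  show "?J \<le> max (ennreal (3 ^ DIM('a)) * E / X c r)
    (wmax lebesgue F (\<lambda>y. ennreal \<bar>f y * indicator (ball c (4 * r)) y\<bar>) x)"
  proof (cases "r' < r")
    case True
    have dx: "dist c x < r" "dist c' x < r'" using x x' by auto
    have "dist c a \<le> dist c x + dist x c' + dist c' a"
      using dist_triangle[of c a x] dist_triangle[of x a c'] by linarith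
    then have "dist c a < 2 * r + dist c' a" using dx True by (simp add: dist_commute)
    \<comment> \<open>Together with \<open>10 * r < \<kappa> * dist c a\<close> this yields
      \<open>8 * r < \<kappa> * dist c' a\<close>, enough for the fivefold dilate of a ball with
      \<open>r' < r\<close>; this is where the factor \<open>1 / 10\<close> comes from.\<close>
    then have "\<kappa> * dist c a < \<kappa> * (2 * r + dist c' a)" using \<kappa> by simp
    moreover have "\<kappa> * (2 * r) \<le> 1 * (2 * r)" using r \<kappa> by (intro mult_right_mono) auto
    moreover have "10 * r < \<kappa> * dist c a" using r by simp
    ultimately have "5 * r' < \<kappa> * dist c' a" using True r(1) unfolding distrib_left by linarith
    then have F: "(c', r') \<in> F" unfolding F_def using True r' pos[OF x'] by simp
    \<comment> \<open>The ball stays within \<open>3 * r\<close> of \<open>c\<close>; radius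
      \<open>4 * r\<close> is convenient because it is two doublings of \<open>r\<close>.\<close>
    have sub: "y \<in> ball c (4 * r)" if "y \<in> ball c' r'" for y
    proof -
      have "dist c y \<le> dist c x + dist x c' + dist c' y"
        using dist_triangle[of c y x] dist_triangle[of x y c'] by linarith
      then show ?thesis using that dx True r(1) by (simp add: dist_commute)
    qed
    have "(\<integral>\<^sup>+ y\<in>ball c' r'. ennreal \<bar>f y\<bar> \<partial>lebesgue)
        = (\<integral>\<^sup>+ y\<in>ball c' r'. ennreal \<bar>f y * indicator (ball c (4 * r)) y\<bar> \<partial>lebesgue)"
      using sub by (intro nn_integral_cong) (auto simp: indicator_def)
    then have "?J \<le> wmax lebesgue F (\<lambda>y. ennreal \<bar>f y * indicator (ball c (4 * r)) y\<bar>) x"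
      using average_le_wmax[OF F x', of lebesgue "\<lambda>y. ennreal \<bar>f y * indicator (ball c (4 * r)) y\<bar>"] by simp
    then show ?thesis by (simp add: le_max_iff_disj)
  next
    case False
    have sub: "ball c r \<subseteq> ball c' (3 * r')"
    proof
      fix y assume y: "y \<in> ball c r"
      have "dist c' y \<le> dist c' x + dist x c + dist c y"
        using dist_triangle[of c' y x] dist_triangle[of x y c] by linarith
      then show "y \<in> ball c' (3 * r')" using y x x' False by (simp add: dist_commute)
    qed
    \<comment> \<open>The average is tested on the tripled ball; returning to
      \<open>ball c' r'\<close> costs \<open>3 ^ DIM('a)\<close>, and \<open>X c r\<close>, being
      positive and finite, is divided out.\<close>
    have "X c r \<le> X c' (3 * r')"
      unfolding X_def using p sub by (intro morrey_norm_mono) (auto simp: indicator_def)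
    then have "X c r * (\<integral>\<^sup>+ y\<in>ball c' r'. ennreal \<bar>f y\<bar> \<partial>lebesgue)
        \<le> X c' (3 * r') * (\<integral>\<^sup>+ y\<in>ball c' (3 * r'). ennreal \<bar>f y\<bar> \<partial>lebesgue)"
      using r' by (intro mult_mono nn_integral_mono) (auto simp: indicator_def)
    also have "\<dots> \<le> E * emeasure lebesgue (ball c' (3 * r'))" using r' by (intro avg) simp
    also have "\<dots> = ennreal (3 ^ DIM('a)) * E * emeasure lebesgue (ball c' r')"
      using emeasure_lebesgue_ball_mult[OF r', of 3 c'] by (simp add: ac_simps)
    finally have "X c r * (\<integral>\<^sup>+ y\<in>ball c' r'. ennreal \<bar>f y\<bar> \<partial>lebesgue) / emeasure lebesgue (ball c' r')
        \<le> ennreal (3 ^ DIM('a)) * E"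
      unfolding divide_le_ennreal_iff[OF V] .
    then have "?J * X c r \<le> ennreal (3 ^ DIM('a)) * E"
      by (simp add: ennreal_times_divide mult.commute)
    then have "?J \<le> ennreal (3 ^ DIM('a)) * E / X c r"
      unfolding ennreal_le_divide_iff[OF X] .
    then show ?thesis by (simp add: le_max_iff_disj)
  qed
qed

lemma set_nn_integral_dilated_morrey_le:
  fixes w :: "'a::euclidean_space \<Rightarrow> real"
  assumes p: "0 < p" and phi: "\<And>c r. 0 < r \<Longrightarrow> 0 < \<phi> (ball c r)"
    and doubling: "\<And>c r. 0 < r \<Longrightarrow> \<phi> (ball c (2 * r)) \<le> D * \<phi> (ball c r)" and D: "0 \<le> D"
    and f[measurable]: "f \<in> borel_measurable lebesgue" and w[measurable]: "w \<in> borel_measurable lebesgue"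
    and r: "0 < r"
  shows "(\<integral>\<^sup>+x. enn_pow p (ennreal \<bar>f x * indicator (ball c (4 * r)) x\<bar>) \<partial>wmeasure w)
    \<le> ennreal (D ^ 2) * enn_pow p (morrey_norm p \<phi> w (\<lambda>x. ennreal \<bar>f x\<bar>)) * ennreal (\<phi> (ball c r))"
proof -
  let ?N = "morrey_norm p \<phi> w (\<lambda>x. ennreal \<bar>f x\<bar>)"
  have [measurable]: "ball c (4 * r) \<in> sets lebesgue" by simp
  have "(\<integral>\<^sup>+x. enn_pow p (ennreal \<bar>f x * indicator (ball c (4 * r)) x\<bar>) \<partial>wmeasure w)
     = (\<integral>\<^sup>+x. ennreal (w x) * enn_pow p (ennreal \<bar>f x * indicator (ball c (4 * r)) x\<bar>) \<partial>lebesgue)"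
    by (rule nn_integral_density) measurable
  also have "\<dots> = (\<integral>\<^sup>+x\<in>ball c (4 * r). enn_pow p (ennreal \<bar>f x\<bar>) * ennreal (w x) \<partial>lebesgue)"
    by (intro nn_integral_cong) (auto simp: indicator_def mult.commute)
  also have "\<dots> \<le> ennreal (\<phi> (ball c (4 * r))) * enn_pow p ?N"
    using r by (intro nn_integral_morrey_le p phi) auto
  also have "\<dots> \<le> ennreal (D ^ 2 * \<phi> (ball c r)) * enn_pow p ?N"
    using doubling_iterate[OF doubling D r, of c 2] by (intro mult_right_mono ennreal_leI) auto
  also have "\<dots> = ennreal (D ^ 2) * enn_pow p ?N * ennreal (\<phi> (ball c r))"
    using D phi[OF r, of c] by (simp add: ennreal_mult ac_simps)
  finally show ?thesis .
qed

lemma phi_admissibleE: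
  fixes \<phi> :: "'a::euclidean_space set \<Rightarrow> real"
  assumes "phi_admissible p \<phi> w"
  obtains D \<delta> C where "\<And>c r. 0 < r \<Longrightarrow> 0 < \<phi> (ball c r)"
    "\<And>c r. 0 < r \<Longrightarrow> \<phi> (ball c (2 * r)) \<le> D * \<phi> (ball c r)" "0 \<le> D" "0 < \<delta>"
    "\<And>c1 r1 c2 r2. 0 < r1 \<Longrightarrow> 0 < r2 \<Longrightarrow> ball c1 r1 \<subseteq> ball c2 r2 \<Longrightarrow>
        \<phi> (ball c1 r1) / \<phi> (ball c2 r2)
          \<le> C * (measure lebesgue (ball c1 r1) / measure lebesgue (ball c2 r2)) powr \<delta>"
    "\<And>c r. 0 < r \<Longrightarrow> morrey_norm p \<phi> w (\<lambda>x. ennreal (indicator (ball c r) x)) < top"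
proof -
  from assms obtain D \<delta> C where *: "\<forall>c r. 0 < r \<longrightarrow> 0 < \<phi> (ball c r)"
    "\<forall>c r. 0 < r \<longrightarrow> \<phi> (ball c (2 * r)) \<le> D * \<phi> (ball c r)" "0 < \<delta>"
    "\<forall>c1 r1 c2 r2. 0 < r1 \<longrightarrow> 0 < r2 \<longrightarrow> ball c1 r1 \<subseteq> ball c2 r2 \<longrightarrow>
        \<phi> (ball c1 r1) / \<phi> (ball c2 r2)
          \<le> C * (measure lebesgue (ball c1 r1) / measure lebesgue (ball c2 r2)) powr \<delta>"
    "\<forall>c r. 0 < r \<longrightarrow> morrey_norm p \<phi> w (\<lambda>x. ennreal (indicator (ball c r) x)) < top"
    unfolding phi_admissible_def by auto
  have "0 < \<phi> (ball 0 2)" "0 < \<phi> (ball 0 1)" "\<phi> (ball 0 2) \<le> D * \<phi> (ball 0 1)"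
    using *(1) *(2)[rule_format, of 1 0] by auto
  then have "0 \<le> D" by (smt (verit) mult_neg_pos)
  show ?thesis
    by (rule that[of D \<delta> C]) (use * \<open>0 \<le> D\<close> in blast)+
qed

text \<open>Serves the covering by annuli around \<open>a\<close>, which leaves out \<open>a\<close>
  itself.\<close>

lemma null_sets_wmeasure_singleton:
  fixes w :: "'a::euclidean_space \<Rightarrow> real"
  assumes [measurable]: "w \<in> borel_measurable lebesgue"
  shows "{a} \<in> null_sets (wmeasure w)"
proof -
  have "AE x in lebesgue. x \<noteq> a"
    by (rule AE_I'[of "{a}"]) (auto simp: null_sets_def)
  then have "AE x in lebesgue. x \<in> {a} \<longrightarrow> ennreal (w x) = 0"
    by (rule eventually_mono) simp
  then show ?thesis
    by (intro null_sets_density_iff[THEN iffD2] conjI) auto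
qed

section \<open>Recentring the local conditions at \<open>a\<close>\<close>

lemma A_p_loc_translate:
  fixes w :: "'a::euclidean_space \<Rightarrow> real"
  assumes wm[measurable]: "w \<in> borel_measurable lebesgue" and "A_p_loc \<kappa> p (\<lambda>x. w (x + a))"
  obtains C where "\<And>c r. 0 < r \<Longrightarrow> r < \<kappa> * dist c a \<Longrightarrow>
      enn_pow (1 / p) (wmeas w (ball c r)) * enn_pow (1 - 1 / p)
        (\<integral>\<^sup>+ x\<in>ball c r. (if w x = 0 then \<infinity> else ennreal (w x powr (1 - p / (p - 1)))) \<partial>lebesgue)
      \<le> ennreal C * emeasure lebesgue (ball c r)"
proof -
  let ?\<sigma> = "\<lambda>x. if w x = 0 then \<infinity> else ennreal (w x powr (1 - p / (p - 1)))"
  have \<sigma>: "?\<sigma> \<in> borel_measurable lebesgue" by (rule borel_measurable_dual_weight[OF wm])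
  obtain C where C: "\<And>c r. 0 < r \<Longrightarrow> r < \<kappa> * norm c \<Longrightarrow>
      enn_pow (1 / p) (wmeas (\<lambda>x. w (x + a)) (ball c r)) *
      enn_pow (1 - 1 / p) (\<integral>\<^sup>+ x\<in>ball c r. ?\<sigma> (x + a) \<partial>lebesgue) \<le> ennreal C * emeasure lebesgue (ball c r)"
    using assms(2) unfolding A_p_loc_def by blast
  show ?thesis
  proof (rule that[of C])
    fix c :: 'a and r :: real assume r: "0 < r" "r < \<kappa> * dist c a"
    have "wmeas (\<lambda>x. w (x + a)) (ball (c - a) r) = wmeas w (ball c r)"
      unfolding wmeas_def using set_nn_integral_ball_translation[of "\<lambda>x. ennreal (w x)"] by simp
    then show "enn_pow (1 / p) (wmeas w (ball c r)) * enn_pow (1 - 1 / p) (\<integral>\<^sup>+ x\<in>ball c r. ?\<sigma> x \<partial>lebesgue)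
      \<le> ennreal C * emeasure lebesgue (ball c r)"
      using C[of r "c - a"] r unfolding set_nn_integral_ball_translation[OF \<sigma>] emeasure_lebesgue_ball_translation
      by (simp add: dist_norm)
  qed
qed

lemma A_1_loc_translate:
  fixes w :: "'a::euclidean_space \<Rightarrow> real"
  assumes wm[measurable]: "w \<in> borel_measurable lebesgue" and "A_1_loc \<kappa> (\<lambda>x. w (x + a))"
  obtains C where "\<And>c r. 0 < r \<Longrightarrow> r < \<kappa> * dist c a \<Longrightarrow> AE x in lebesgue. x \<in> ball c r \<longrightarrow>
         wmeas w (ball c r) \<le> ennreal C * emeasure lebesgue (ball c r) * ennreal (w x)"
proof -
  obtain C where C: "\<And>c r. 0 < r \<Longrightarrow> r < \<kappa> * norm c \<Longrightarrow> AE x in lebesgue. x \<in> ball c r \<longrightarrow>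
      wmeas (\<lambda>x. w (x + a)) (ball c r) \<le> ennreal C * emeasure lebesgue (ball c r) * ennreal (w (x + a))"
    using assms(2) unfolding A_1_loc_def by blast
  show ?thesis
  proof (rule that[of C])
    fix c :: 'a and r :: real assume r: "0 < r" "r < \<kappa> * dist c a"
    have [measurable]: "ball c r \<in> sets lebesgue" by simp
    have W: "wmeas (\<lambda>x. w (x + a)) (ball (c - a) r) = wmeas w (ball c r)"
      unfolding wmeas_def using set_nn_integral_ball_translation[of "\<lambda>x. ennreal (w x)"] by simp
    have B: "x + a \<in> ball c r \<longleftrightarrow> x \<in> ball (c - a) r" for x
      by (simp add: dist_norm algebra_simps)
    have meas: "{x \<in> space lebesgue. x \<in> ball c r \<longrightarrow>
         wmeas w (ball c r) \<le> ennreal C * emeasure lebesgue (ball c r) * ennreal (w x)} \<in> sets lebesgue"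
      by measurable
    have "r < \<kappa> * norm (c - a)" using r by (simp add: dist_norm)
    from C[OF r(1) this] have "AE x in lebesgue. x + a \<in> ball c r \<longrightarrow>
         wmeas w (ball c r) \<le> ennreal C * emeasure lebesgue (ball c r) * ennreal (w (x + a))"
      unfolding W B emeasure_lebesgue_ball_translation .
    then show "AE x in lebesgue. x \<in> ball c r \<longrightarrow>
         wmeas w (ball c r) \<le> ennreal C * emeasure lebesgue (ball c r) * ennreal (w x)"
      by (rule AE_lebesgue_translation) (use meas in \<open>simp only: space_completion space_lborel space_borel UNIV_I simp_thms\<close>)
  qed
qed

section \<open>The two sufficiency statements\<close>

lemma M_bdd_if_A_morrey:
  fixes w :: "'a::euclidean_space \<Rightarrow> real"
  assumes w: "weight w" and \<kappa>: "0 < \<kappa>" "\<kappa> < 1" and p: "1 < p"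
    and adm: "phi_admissible p \<phi> w" and A: "A_morrey p \<phi> w" and Ap: "A_p_loc \<kappa> p (\<lambda>x. w (x + a))"
  shows "M_bdd p \<phi> w"
proof -
  let ?W = "wmeasure w"
  define X where "X c r = morrey_norm p \<phi> w (\<lambda>x. ennreal (indicator (ball c r) x))" for c r
  have wm[measurable]: "w \<in> borel_measurable lebesgue" using w by (auto simp: weight_def)
  have ball[measurable]: "ball c r \<in> sets lebesgue" for c :: 'a and r by simp
  from adm obtain D \<delta> C\<phi> where phi: "\<And>c r. 0 < r \<Longrightarrow> 0 < \<phi> (ball c r)"
    and doubling: "\<And>c r. 0 < r \<Longrightarrow> \<phi> (ball c (2 * r)) \<le> D * \<phi> (ball c r)" and D: "0 \<le> D"
    and \<delta>: "0 < \<delta>"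
    and rev: "\<And>c1 r1 c2 r2. 0 < r1 \<Longrightarrow> 0 < r2 \<Longrightarrow> ball c1 r1 \<subseteq> ball c2 r2 \<Longrightarrow>
        \<phi> (ball c1 r1) / \<phi> (ball c2 r2)
          \<le> C\<phi> * (measure lebesgue (ball c1 r1) / measure lebesgue (ball c2 r2)) powr \<delta>"
    and X_top: "\<And>c r. 0 < r \<Longrightarrow> X c r < top"
    unfolding X_def by (rule phi_admissibleE) blast
  obtain CA where CA: "\<And>c r. 0 < r \<Longrightarrow> morrey_norm p \<phi> w (\<lambda>x. ennreal (indicator (ball c r) x))
      * kothe_norm (morrey_norm p \<phi> w) (indicator (ball c r)) \<le> ennreal CA * emeasure lebesgue (ball c r)"
    using A unfolding A_morrey_def by blast
  obtain C where C: "\<And>c r. 0 < r \<Longrightarrow> r < \<kappa> * dist c a \<Longrightarrow>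
      enn_pow (1 / p) (wmeas w (ball c r)) * enn_pow (1 - 1 / p)
        (\<integral>\<^sup>+ x\<in>ball c r. (if w x = 0 then \<infinity> else ennreal (w x powr (1 - p / (p - 1)))) \<partial>lebesgue)
      \<le> ennreal C * emeasure lebesgue (ball c r)"
    using A_p_loc_translate[OF wm Ap] by blast
  obtain K where K: "K < top" and max: "\<And>F R f.
    (\<And>c r. (c, r) \<in> F \<Longrightarrow> 0 < r \<and> r \<le> R \<and> 5 * r < \<kappa> * dist c a \<and> 0 < emeasure ?W (ball c r)) \<Longrightarrow>
    f \<in> borel_measurable lebesgue \<Longrightarrow>
    (\<integral>\<^sup>+x. enn_pow p (wmax lebesgue F (\<lambda>y. ennreal \<bar>f y\<bar>) x) \<partial>?W)
      \<le> K * (\<integral>\<^sup>+x. enn_pow p (ennreal \<bar>f x\<bar>) \<partial>?W)"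
    by (rule local_A_p_maximal[OF w p C]) blast+
  have \<epsilon>: "0 < \<kappa> / 10" "\<kappa> / 10 \<le> 1" using \<kappa> by auto
  obtain L where L: "0 \<le> L" "\<And>(\<nu> :: 'a measure) K c r. sets \<nu> = sets lebesgue \<Longrightarrow> emeasure \<nu> {a} = 0 \<Longrightarrow>
      (\<And>c r. 0 < r \<Longrightarrow> r < \<kappa> / 10 * dist c a \<Longrightarrow> emeasure \<nu> (ball c r) \<le> K * ennreal (\<phi> (ball c r))) \<Longrightarrow>
      0 < r \<Longrightarrow> emeasure \<nu> (ball c r) \<le> ennreal L * K * ennreal (\<phi> (ball c r))"
    by (rule local_bound_imp_global_bound[OF phi doubling \<delta> rev \<epsilon>, of a]) blast+
  define Q where "Q = ennreal (3 ^ DIM('a)) * ennreal CA"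
  define K' where "K' = enn_pow p Q + K * ennreal (D ^ 2)"
  have "ennreal L * K' < top"
    using K by (simp add: K'_def Q_def ennreal_mult_eq_top_iff flip: top.not_eq_extremum)
  \<comment> \<open>The root appears because the measure \<open>\<nu>\<close> below is built from
    p-th powers.\<close>
  then obtain C' where C': "enn_pow (1 / p) (ennreal L * K') = ennreal C'"
    by (cases "enn_pow (1 / p) (ennreal L * K')") auto
  have "morrey_norm p \<phi> w (hl_max f) \<le> ennreal C' * morrey_norm p \<phi> w (\<lambda>x. ennreal \<bar>f x\<bar>)"
    if f[measurable]: "f \<in> borel_measurable lebesgue" and fin: "morrey_norm p \<phi> w (\<lambda>x. ennreal \<bar>f x\<bar>) < \<infinity>"
    for f :: "'a \<Rightarrow> real"
  proof -
    define N where "N = morrey_norm p \<phi> w (\<lambda>x. ennreal \<bar>f x\<bar>)"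
    have hl[measurable]: "hl_max f \<in> borel_measurable lebesgue" unfolding hl_max_eq_wmax by measurable
    have avg: "X c r * (\<integral>\<^sup>+ y\<in>ball c r. ennreal \<bar>f y\<bar> \<partial>lebesgue) \<le> (ennreal CA * N) * emeasure lebesgue (ball c r)"
      if "0 < r" for c r
      unfolding X_def N_def using p by (intro A_morrey_average[OF _ phi CA f wm fin that]) auto
    \<comment> \<open>For this measure the Morrey bound of \<open>hl_max f\<close> says that
      \<open>\<nu>\<close> is bounded by \<open>\<phi>\<close> on all balls, so small balls
      suffice.\<close>
    define \<nu> where "\<nu> = density ?W (\<lambda>x. enn_pow p (hl_max f x))"
    have loc: "emeasure \<nu> (ball c r) \<le> K' * enn_pow p N * ennreal (\<phi> (ball c r))"
      if r: "0 < r" "r < \<kappa> / 10 * dist c a" for c r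
    proof (cases "emeasure ?W (ball c r) = 0")
      case True
      then have "emeasure \<nu> (ball c r) = 0"
        unfolding \<nu>_def
        by (subst emeasure_density) (auto intro!: nn_integral_null_set simp: null_sets_def)
      then show ?thesis by simp
    next
      case False
      \<comment> \<open>The supremum in \<open>X c r\<close> tested on the ball itself. It shows
        that \<open>X c r\<close> is positive, and later it cancels the denominator of
        \<open>q\<close>.\<close>
      have WX: "emeasure ?W (ball c r) \<le> ennreal (\<phi> (ball c r)) * enn_pow p (X c r)"
        unfolding X_def using p by (intro nn_integral_indicator_morrey phi r wm) auto
      then have X: "0 < X c r" "X c r < top"
        using False X_top[OF r(1)] by (auto simp: zero_less_iff_neq_zero)
      define F where "F = {(c', r'). 0 < r' \<and> r' \<le> r \<and> 5 * r' < \<kappa> * dist c' a \<and> 0 < emeasure ?W (ball c' r')}"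
      define M where "M = wmax lebesgue F (\<lambda>y. ennreal \<bar>f y * indicator (ball c (4 * r)) y\<bar>)"
      have M[measurable]: "M \<in> borel_measurable lebesgue" unfolding M_def by measurable
      define q where "q = Q * N / X c r"
      have "emeasure \<nu> (ball c r) = (\<integral>\<^sup>+x\<in>ball c r. enn_pow p (hl_max f x) \<partial>?W)"
        unfolding \<nu>_def by (subst emeasure_density) auto
      also have "\<dots> \<le> (\<integral>\<^sup>+x. enn_pow p q * indicator (ball c r) x + enn_pow p (M x) \<partial>?W)"
      proof (rule nn_integral_mono_AE, rule AE_mp[OF AE_all_balls_positive[of ?W]])
        show "AE x in ?W. (\<forall>c r. x \<in> ball c r \<longrightarrow> 0 < emeasure ?W (ball c r)) \<longrightarrow>
          enn_pow p (hl_max f x) * indicator (ball c r) x \<le> enn_pow p q * indicator (ball c r) x + enn_pow p (M x)"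
        proof (intro AE_I2 impI)
          fix x assume pos: "\<forall>c r. x \<in> ball c r \<longrightarrow> 0 < emeasure ?W (ball c r)"
          show "enn_pow p (hl_max f x) * indicator (ball c r) x \<le> enn_pow p q * indicator (ball c r) x + enn_pow p (M x)"
          proof (cases "x \<in> ball c r")
            case True
            have "hl_max f x \<le> max q (M x)"
              unfolding q_def Q_def M_def F_def X_def mult.assoc
              by (rule hl_max_le_local[where p = p and w = w and a = a and \<kappa> = \<kappa>])
                (use p \<kappa> avg r X True pos in \<open>auto simp: X_def\<close>)
            then have "enn_pow p (hl_max f x) \<le> enn_pow p (max q (M x))" using p by (intro enn_pow_mono) auto
            also have "\<dots> \<le> enn_pow p q + enn_pow p (M x)" by (auto simp: max_def)
            finally show ?thesis using True by simp
          qed simp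
        qed
      qed simp
      also have "\<dots> = enn_pow p q * emeasure ?W (ball c r) + (\<integral>\<^sup>+x. enn_pow p (M x) \<partial>?W)"
        by (subst nn_integral_add) (auto simp: nn_integral_cmult_indicator)
      also have "\<dots> \<le> enn_pow p (Q * N) * ennreal (\<phi> (ball c r))
          + K * (ennreal (D ^ 2) * enn_pow p N * ennreal (\<phi> (ball c r)))"
      proof (rule add_mono)
        have "enn_pow p q * emeasure ?W (ball c r) \<le> enn_pow p q * (ennreal (\<phi> (ball c r)) * enn_pow p (X c r))"
          by (rule mult_left_mono[OF WX]) simp
        also have "\<dots> = enn_pow p (q * X c r) * ennreal (\<phi> (ball c r))"
          by (simp add: enn_pow_mult ac_simps)
        also have "q * X c r = Q * N" unfolding q_def by (rule average_times_emeasure[OF X])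
        finally show "enn_pow p q * emeasure ?W (ball c r) \<le> enn_pow p (Q * N) * ennreal (\<phi> (ball c r))" .
        have "(\<integral>\<^sup>+x. enn_pow p (M x) \<partial>?W)
            \<le> K * (\<integral>\<^sup>+x. enn_pow p (ennreal \<bar>f x * indicator (ball c (4 * r)) x\<bar>) \<partial>?W)"
          unfolding M_def by (rule max[of F r]) (auto simp: F_def)
        also have "\<dots> \<le> K * (ennreal (D ^ 2) * enn_pow p N * ennreal (\<phi> (ball c r)))"
          unfolding N_def using p
          by (intro mult_left_mono set_nn_integral_dilated_morrey_le phi doubling D f wm r) auto
        finally show "(\<integral>\<^sup>+x. enn_pow p (M x) \<partial>?W) \<le> K * (ennreal (D ^ 2) * enn_pow p N * ennreal (\<phi> (ball c r)))" .
      qed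
      also have "\<dots> = K' * enn_pow p N * ennreal (\<phi> (ball c r))"
        by (simp add: K'_def enn_pow_mult distrib_right mult.assoc)
      finally show ?thesis .
    qed
    have a0: "emeasure \<nu> {a} = 0"
      unfolding \<nu>_def using null_sets_wmeasure_singleton[OF wm, of a]
      by (subst emeasure_density) (auto intro!: nn_integral_null_set)
    have "(\<integral>\<^sup>+x\<in>ball c r. enn_pow p (hl_max f x) * ennreal (w x) \<partial>lebesgue)
        \<le> ennreal (\<phi> (ball c r)) * enn_pow p (ennreal C' * N)" if r: "0 < r" for c r
    proof -
      have "(\<integral>\<^sup>+x\<in>ball c r. enn_pow p (hl_max f x) * ennreal (w x) \<partial>lebesgue) = emeasure \<nu> (ball c r)"
        unfolding \<nu>_def by (simp add: emeasure_density nn_integral_density ac_simps)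
      also have "\<dots> \<le> ennreal L * (K' * enn_pow p N) * ennreal (\<phi> (ball c r))"
        by (rule L(2)[OF _ a0 loc r]) (auto simp: \<nu>_def)
      also have "\<dots> = ennreal (\<phi> (ball c r)) * (enn_pow p (ennreal C') * enn_pow p N)"
        unfolding C'[symmetric] using p by (simp add: ac_simps)
      finally show ?thesis by (simp add: enn_pow_mult)
    qed
    then show ?thesis
      using morrey_norm_le_iff[of p \<phi> w "hl_max f"] p phi unfolding N_def by auto
  qed
  then show ?thesis unfolding M_bdd_def by blast
qed

lemma M_bdd_weak_if_A_morrey:
  fixes w :: "'a::euclidean_space \<Rightarrow> real"
  assumes w: "weight w" and \<kappa>: "0 < \<kappa>" "\<kappa> < 1"
    and adm: "phi_admissible 1 \<phi> w" and A: "A_morrey 1 \<phi> w" and A1: "A_1_loc \<kappa> (\<lambda>x. w (x + a))"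
  shows "M_bdd_weak 1 \<phi> w"
proof -
  let ?W = "wmeasure w"
  define X where "X c r = morrey_norm 1 \<phi> w (\<lambda>x. ennreal (indicator (ball c r) x))" for c r
  have wm[measurable]: "w \<in> borel_measurable lebesgue" using w by (auto simp: weight_def)
  have ball[measurable]: "ball c r \<in> sets lebesgue" for c :: 'a and r by simp
  from adm obtain D \<delta> C\<phi> where phi: "\<And>c r. 0 < r \<Longrightarrow> 0 < \<phi> (ball c r)"
    and doubling: "\<And>c r. 0 < r \<Longrightarrow> \<phi> (ball c (2 * r)) \<le> D * \<phi> (ball c r)" and D: "0 \<le> D"
    and \<delta>: "0 < \<delta>"
    and rev: "\<And>c1 r1 c2 r2. 0 < r1 \<Longrightarrow> 0 < r2 \<Longrightarrow> ball c1 r1 \<subseteq> ball c2 r2 \<Longrightarrow>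
        \<phi> (ball c1 r1) / \<phi> (ball c2 r2)
          \<le> C\<phi> * (measure lebesgue (ball c1 r1) / measure lebesgue (ball c2 r2)) powr \<delta>"
    and X_top: "\<And>c r. 0 < r \<Longrightarrow> X c r < top"
    unfolding X_def by (rule phi_admissibleE) blast
  obtain CA where CA: "\<And>c r. 0 < r \<Longrightarrow> morrey_norm 1 \<phi> w (\<lambda>x. ennreal (indicator (ball c r) x))
      * kothe_norm (morrey_norm 1 \<phi> w) (indicator (ball c r)) \<le> ennreal CA * emeasure lebesgue (ball c r)"
    using A unfolding A_morrey_def by blast
  obtain C where C: "\<And>c r. 0 < r \<Longrightarrow> r < \<kappa> * dist c a \<Longrightarrow> AE x in lebesgue. x \<in> ball c r \<longrightarrow>
         wmeas w (ball c r) \<le> ennreal C * emeasure lebesgue (ball c r) * ennreal (w x)"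
    using A_1_loc_translate[OF wm A1] by blast
  obtain K where K: "K < top" and max: "\<And>F R f t.
    (\<And>c r. (c, r) \<in> F \<Longrightarrow> 0 < r \<and> r \<le> R \<and> 5 * r < \<kappa> * dist c a \<and> 0 < emeasure ?W (ball c r)) \<Longrightarrow>
    f \<in> borel_measurable lebesgue \<Longrightarrow>
    t * emeasure ?W {x. t < wmax lebesgue F (\<lambda>y. ennreal \<bar>f y\<bar>) x} \<le> K * (\<integral>\<^sup>+x. ennreal \<bar>f x\<bar> \<partial>?W)"
    by (rule local_A_1_maximal[OF w C]) blast+
  have \<epsilon>: "0 < \<kappa> / 10" "\<kappa> / 10 \<le> 1" using \<kappa> by auto
  obtain L where L: "0 \<le> L" "\<And>(\<nu> :: 'a measure) K c r. sets \<nu> = sets lebesgue \<Longrightarrow> emeasure \<nu> {a} = 0 \<Longrightarrow>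
      (\<And>c r. 0 < r \<Longrightarrow> r < \<kappa> / 10 * dist c a \<Longrightarrow> emeasure \<nu> (ball c r) \<le> K * ennreal (\<phi> (ball c r))) \<Longrightarrow>
      0 < r \<Longrightarrow> emeasure \<nu> (ball c r) \<le> ennreal L * K * ennreal (\<phi> (ball c r))"
    by (rule local_bound_imp_global_bound[OF phi doubling \<delta> rev \<epsilon>, of a]) blast+
  define Q where "Q = ennreal (3 ^ DIM('a)) * ennreal CA"
  define K' where "K' = Q + K * ennreal (D ^ 2)"
  have "ennreal L * K' < top"
    using K by (simp add: K'_def Q_def ennreal_mult_eq_top_iff flip: top.not_eq_extremum)
  then obtain C' where C': "ennreal L * K' = ennreal C'"
    by (cases "ennreal L * K'") auto
  have "weak_morrey_norm 1 \<phi> w (hl_max f) \<le> ennreal C' * morrey_norm 1 \<phi> w (\<lambda>x. ennreal \<bar>f x\<bar>)"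
    if f[measurable]: "f \<in> borel_measurable lebesgue" and fin: "morrey_norm 1 \<phi> w (\<lambda>x. ennreal \<bar>f x\<bar>) < \<infinity>"
    for f :: "'a \<Rightarrow> real"
  proof -
    define N where "N = morrey_norm 1 \<phi> w (\<lambda>x. ennreal \<bar>f x\<bar>)"
    have avg: "X c r * (\<integral>\<^sup>+ y\<in>ball c r. ennreal \<bar>f y\<bar> \<partial>lebesgue) \<le> (ennreal CA * N) * emeasure lebesgue (ball c r)"
      if "0 < r" for c r
      unfolding X_def N_def by (intro A_morrey_average[OF _ phi CA f wm fin that]) auto
    have level: "ennreal t * enn_pow (1 / 1) (wmeas w {x \<in> ball c r. hl_max f x > ennreal t} * ennreal (1 / \<phi> (ball c r)))
        \<le> ennreal C' * N" if r0: "0 < r" and t: "0 < t" for c r t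
    proof -
      define S where "S = {x. ennreal t < hl_max f x}"
      have S[measurable]: "S \<in> sets lebesgue"
        unfolding S_def hl_max_eq_wmax by (rule wmax_superlevel_lebesgue)
      \<comment> \<open>One level at a time: the restriction of \<open>w\<close> to the superlevel
        set is a measure to which the passage from small to all balls applies, with the same
        \<open>L\<close> for every \<open>t\<close>.\<close>
      define \<nu> where "\<nu> = density ?W (indicator S)"
      have \<nu>: "emeasure \<nu> B = emeasure ?W (B \<inter> S)" if [measurable]: "B \<in> sets lebesgue" for B
      proof -
        have "emeasure \<nu> B = (\<integral>\<^sup>+x. indicator S x * indicator B x \<partial>?W)"
          unfolding \<nu>_def by (rule emeasure_density) auto
        also have "\<dots> = (\<integral>\<^sup>+x. indicator (B \<inter> S) x \<partial>?W)"
          by (intro nn_integral_cong) (auto simp: indicator_def)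
        also have "\<dots> = emeasure ?W (B \<inter> S)" by (rule nn_integral_indicator) simp
        finally show ?thesis .
      qed
      have loc: "emeasure \<nu> (ball c r) \<le> K' * N / ennreal t * ennreal (\<phi> (ball c r))"
        if r: "0 < r" "r < \<kappa> / 10 * dist c a" for c r
      proof (cases "emeasure ?W (ball c r) = 0")
        case True
        moreover have "emeasure ?W (ball c r \<inter> S) \<le> emeasure ?W (ball c r)"
          by (intro emeasure_mono) auto
        ultimately have "emeasure \<nu> (ball c r) = 0" unfolding \<nu>[OF ball] by simp
        then show ?thesis by simp
      next
        case False
        have WX: "emeasure ?W (ball c r) \<le> ennreal (\<phi> (ball c r)) * X c r"
          using nn_integral_indicator_morrey[of 1 \<phi> r w c] phi r wm unfolding X_def by simp
        then have X: "0 < X c r" "X c r < top"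
          using False X_top[OF r(1)] by (auto simp: zero_less_iff_neq_zero)
        define F where "F = {(c', r'). 0 < r' \<and> r' \<le> r \<and> 5 * r' < \<kappa> * dist c' a \<and> 0 < emeasure ?W (ball c' r')}"
        define M where "M = wmax lebesgue F (\<lambda>y. ennreal \<bar>f y * indicator (ball c (4 * r)) y\<bar>)"
        define q where "q = Q * N / X c r"
        \<comment> \<open>The constant \<open>q\<close> exceeds \<open>t\<close> everywhere or
          nowhere, so this part of the bound contributes the whole ball or nothing.\<close>
        define U where "U = (if ennreal t < q then ball c r else {})"
        have [measurable]: "U \<in> sets lebesgue" "{x. ennreal t < M x} \<in> sets lebesgue"
          unfolding U_def M_def by (auto simp: wmax_superlevel_lebesgue)
        have "emeasure \<nu> (ball c r) \<le> emeasure ?W (U \<union> {x. ennreal t < M x})"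
          unfolding \<nu>[OF ball]
        proof (rule emeasure_mono_AE, rule AE_mp[OF AE_all_balls_positive[of ?W]])
          show "AE x in ?W. (\<forall>c r. x \<in> ball c r \<longrightarrow> 0 < emeasure ?W (ball c r)) \<longrightarrow>
            x \<in> ball c r \<inter> S \<longrightarrow> x \<in> U \<union> {x. ennreal t < M x}"
          proof (intro AE_I2 impI)
            fix x assume pos: "\<forall>c r. x \<in> ball c r \<longrightarrow> 0 < emeasure ?W (ball c r)" and x: "x \<in> ball c r \<inter> S"
            have "hl_max f x \<le> max q (M x)"
              unfolding q_def Q_def M_def F_def X_def mult.assoc
              by (rule hl_max_le_local[where p = 1 and w = w and a = a and \<kappa> = \<kappa>])
                (use \<kappa> avg r X x pos in \<open>auto simp: X_def\<close>)
            moreover have "ennreal t < hl_max f x" using x by (simp add: S_def)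
            ultimately have "ennreal t < max q (M x)" by (rule less_le_trans[rotated])
            then show "x \<in> U \<union> {x. ennreal t < M x}" using x by (auto simp: U_def less_max_iff_disj)
          qed
        qed auto
        also have "\<dots> \<le> emeasure ?W U + emeasure ?W {x. ennreal t < M x}"
          by (rule emeasure_subadditive) auto
        finally have "ennreal t * emeasure \<nu> (ball c r)
            \<le> ennreal t * emeasure ?W U + ennreal t * emeasure ?W {x. ennreal t < M x}"
          unfolding distrib_left[symmetric] by (rule mult_left_mono) simp
        also have "\<dots> \<le> Q * N * ennreal (\<phi> (ball c r)) + K * (ennreal (D ^ 2) * N * ennreal (\<phi> (ball c r)))"
        proof (rule add_mono)
          show "ennreal t * emeasure ?W U \<le> Q * N * ennreal (\<phi> (ball c r))"
          proof (cases "ennreal t < q")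
            case True
            then have "ennreal t * emeasure ?W U \<le> q * (ennreal (\<phi> (ball c r)) * X c r)"
              using WX by (intro mult_mono) (auto simp: U_def)
            also have "\<dots> = q * X c r * ennreal (\<phi> (ball c r))" by (simp add: ac_simps)
            also have "q * X c r = Q * N" unfolding q_def by (rule average_times_emeasure[OF X])
            finally show ?thesis .
          qed (simp add: U_def)
          have "ennreal t * emeasure ?W {x. ennreal t < M x}
              \<le> K * (\<integral>\<^sup>+x. ennreal \<bar>f x * indicator (ball c (4 * r)) x\<bar> \<partial>?W)"
            unfolding M_def by (rule max[of F r]) (auto simp: F_def)
          also have "\<dots> \<le> K * (ennreal (D ^ 2) * N * ennreal (\<phi> (ball c r)))"
            using set_nn_integral_dilated_morrey_le[of 1 \<phi> D f w r c] phi doubling D f wm r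
            unfolding N_def by (intro mult_left_mono) auto
          finally show "ennreal t * emeasure ?W {x. ennreal t < M x} \<le> K * (ennreal (D ^ 2) * N * ennreal (\<phi> (ball c r)))" .
        qed
        also have "\<dots> = K' * N * ennreal (\<phi> (ball c r))"
          by (simp add: K'_def distrib_right mult.assoc)
        finally have "emeasure \<nu> (ball c r) \<le> K' * N * ennreal (\<phi> (ball c r)) / ennreal t"
          using t by (simp add: ennreal_le_divide_iff mult.commute)
        then show ?thesis by (simp add: ennreal_times_divide mult.commute)
      qed
      have a0: "emeasure \<nu> {a} = 0"
        unfolding \<nu>_def using null_sets_wmeasure_singleton[OF wm, of a]
        by (subst emeasure_density) (auto intro!: nn_integral_null_set)
      have "{x \<in> ball c r. hl_max f x > ennreal t} = ball c r \<inter> S" by (auto simp: S_def)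
      then have "wmeas w {x \<in> ball c r. hl_max f x > ennreal t} = emeasure ?W (ball c r \<inter> S)"
        by (simp add: wmeas_eq_emeasure)
      also have "\<dots> = emeasure \<nu> (ball c r)" by (simp add: \<nu>)
      also have "\<dots> \<le> ennreal L * (K' * N / ennreal t) * ennreal (\<phi> (ball c r))"
        by (rule L(2)[OF _ a0 loc r0]) (auto simp: \<nu>_def)
      also have "\<dots> = ennreal C' * N / ennreal t * ennreal (\<phi> (ball c r))"
        unfolding C'[symmetric] by (simp add: ennreal_times_divide mult.assoc)
      finally have "ennreal t * (wmeas w {x \<in> ball c r. hl_max f x > ennreal t} * ennreal (1 / \<phi> (ball c r)))
          \<le> ennreal t * (ennreal C' * N / ennreal t * ennreal (\<phi> (ball c r)) * ennreal (1 / \<phi> (ball c r)))"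
        by (intro mult_left_mono mult_right_mono) auto
      also have "\<dots> = (ennreal C' * N / ennreal t * ennreal t) * (ennreal (\<phi> (ball c r)) * ennreal (1 / \<phi> (ball c r)))"
        by (simp add: ac_simps)
      also have "ennreal (\<phi> (ball c r)) * ennreal (1 / \<phi> (ball c r)) = 1"
        using phi[OF r0, of c] by (simp flip: ennreal_mult)
      also have "ennreal C' * N / ennreal t * ennreal t = ennreal C' * N"
        using t by (intro average_times_emeasure) auto
      finally show ?thesis by simp
    qed
    show ?thesis
      unfolding weak_morrey_norm_def N_def[symmetric] using level by (intro SUP_least) auto
  qed
  then show ?thesis unfolding M_bdd_weak_def by blast
qed

theorem theorem5p1:
  fixes w :: "'a::euclidean_space \<Rightarrow> real" and \<phi> :: "'a set \<Rightarrow> real" and \<kappa> :: real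
  assumes "weight w" and "0 < \<kappa>" and "\<kappa> < 1"
  shows "(\<forall>p. 1 \<le> p \<longrightarrow> phi_admissible p \<phi> w \<longrightarrow> M_bdd_weak p \<phi> w \<longrightarrow> A_morrey p \<phi> w)
    \<and> (\<forall>p. 1 < p \<longrightarrow> phi_admissible p \<phi> w \<longrightarrow> A_morrey p \<phi> w \<longrightarrow>
          (\<exists>a. A_p_loc \<kappa> p (\<lambda>x. w (x + a))) \<longrightarrow> M_bdd p \<phi> w)
    \<and> (phi_admissible 1 \<phi> w \<longrightarrow> A_morrey 1 \<phi> w \<longrightarrow>
          (\<exists>a. A_1_loc \<kappa> (\<lambda>x. w (x + a))) \<longrightarrow> M_bdd_weak 1 \<phi> w)"
proof (intro conjI allI impI; (elim exE)?)
  fix p :: real assume "1 \<le> p" "phi_admissible p \<phi> w" "M_bdd_weak p \<phi> w"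
  then show "A_morrey p \<phi> w"
    by (intro A_morrey_if_M_bdd_weak) (auto simp: phi_admissible_def)
next
  fix p :: real and a :: 'a
  assume "1 < p" "phi_admissible p \<phi> w" "A_morrey p \<phi> w" "A_p_loc \<kappa> p (\<lambda>x. w (x + a))"
  then show "M_bdd p \<phi> w" by (rule M_bdd_if_A_morrey[OF assms])
next
  fix a :: 'a
  assume "phi_admissible 1 \<phi> w" "A_morrey 1 \<phi> w" "A_1_loc \<kappa> (\<lambda>x. w (x + a))"
  then show "M_bdd_weak 1 \<phi> w" by (rule M_bdd_weak_if_A_morrey[OF assms])
qed

end
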